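(* Let $N$ be a positive integer and let $\alpha_1,\alpha_2>-1$ and $\beta$ be real parameters. Let $b_n,c_n,d_n$ be the multiple Hahn recurrence coefficients given in the context, and let $T_m$, $m\in\{1,\dots,N+1\}$, be the corresponding truncations of the tetradiagonal recurrence matrix. For $n\ge 0$ set $$a_{6n+1}=\frac{(N-2n)(\alpha_1+1+n)(\alpha_1+\beta+2n+1)(\alpha_2+\beta+2n+1)}{(\alpha_1+\beta+3n+1)_2(\alpha_2+\beta+3n+1)},$$ $$a_{6n+4}=\frac{(N-2n-1)(\alpha_2+1+n)(\alpha_1+\beta+2n+2)(\alpha_2+\beta+2n+2)}{(\alpha_1+\beta+3n+3)(\alpha_2+\beta+3n+2)_2},$$ $$a_{6n+2}=\frac{(N-2n)(n)_n(\beta+2n+1)(\alpha_2-\alpha_1+n)(\alpha_2+\beta+n+1)}{(n+1)_n(\alpha_1+\beta+3n+2)(\alpha_2+\beta+3n+1)_2}\cdot\frac{{}_3F_2\left[{-n,\,-N,\,\alpha_2-\alpha_1-n\atop -2n+1,\ \alpha_2+\beta+n+1};1\right]}{{}_3F_2\left[{-n,\,-N,\,\alpha_2-\alpha_1-n\atop -2n,\ \alpha_2+\beta+n+2};1\right]},$$ $$a_{6n+5}=\frac{(n+1)(N-2n-1)(\beta+2n+2)(\alpha_1-\alpha_2+n+1)(\alpha_1+\beta+2+n+N)}{(2n+1)(\alpha_1+\beta+3n+3)_2(\alpha_2+\beta+3n+3)}\cdot\frac{{}_3F_2\left[{-n,\,-N,\,\alpha_2-\alpha_1-n\atop -2n,\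 \alpha_2+\beta+n+2};1\right]}{{}_3F_2\left[{-n-1,\,-N,\,\alpha_2-\alpha_1-n-1\atop -2n-1,\ \alpha_2+\beta+n+2};1\right]},$$ $$a_{6n+3}=\frac{(2n+1)(\beta+2n+1)(\alpha_1+\beta+2n+2)(\alpha_2+\beta+2n+2)}{(\alpha_1+\beta+3n+2)_2(\alpha_2+\beta+3n+2)}\cdot\frac{{}_3F_2\left[{-n-1,\,-N,\,\alpha_2-\alpha_1-n-1\atop -2n-1,\ \alpha_2+\beta+n+2};1\right]}{{}_3F_2\left[{-n,\,-N,\,\alpha_2-\alpha_1-n\atop -2n,\ \alpha_2+\beta+n+2};1\right]},$$ $$a_{6n+6}=\frac{2(n+1)(\beta+2n+2)(\alpha_1+\beta+2n+3)(\alpha_2+\beta+2n+3)(\alpha_2+\beta+2+n+N)}{(\alpha_1+\beta+3n+4)(\alpha_2+\beta+3n+3)_2(\alpha_2+\beta+n+2)}\cdot\frac{{}_3F_2\left[{-n-1,\,-N,\,\alpha_2-\alpha_1-n-1\atop -2n-2,\ \alpha_2+\beta+n+3};1\right]}{{}_3F_2\left[{-n-1,\,-N,\,\alpha_2-\alpha_1-n-1\atop -2n-1,\ \alpha_2+\beta+n+2};1\right]}.$$ Then the recurrence matrix satisfies the bidiagonal factorization $T_m=L_{1,m}L_{2,m}U_m$, $m\in\{1,\dots,N+1\}$, with $L_{1,m},L_{2,m},U_m$ built from these $a_n$ as in the context. Moreover, this is a positive bidiagonal factorization (that is, the coefficients $a_n$ are positive) in the "semi-band", i.e. whenever $-1<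\alpha_1-\alpha_2<0$.
   Context: Matrices. Given sequences $(b_n)_{n\ge0},(c_n)_{n\ge1},(d_n)_{n\ge2}$, $T_m$ is the $m\times m$ matrix (rows and columns numbered from $1$) with $(T_m)_{i,i}=b_{i-1}$, $(T_m)_{i,i+1}=1$, $(T_m)_{i+1,i}=c_i$, $(T_m)_{i+2,i}=d_{i+1}$ and all other entries $0$. Given $(a_n)_{n\ge1}$: $L_{1,m}$ is the $m\times m$ lower bidiagonal matrix with $1$'s on the diagonal and $(L_{1,m})_{i+1,i}=a_{3i-1}$ (i.e. $a_2,a_5,\dots,a_{3m-4}$); $L_{2,m}$ is lower bidiagonal with $1$'s on the diagonal and $(L_{2,m})_{i+1,i}=a_{3i}$ (i.e. $a_3,a_6,\dots,a_{3m-3}$); $U_m$ is upper bidiagonal with diagonal entries $(U_m)_{i,i}=a_{3i-2}$ (i.e. $a_1,a_4,\dots,a_{3m-2}$) and $1$'s on the superdiagonal. Notation. $(x)_k=x(x+1)\cdots(x+k-1)$, $(x)_0=1$ (in particular $(0)_0=1$). ${}_3F_2\left[{-p,\,x,\,y\atop u,\,v};1\right]$ with $p$ a nonnegative integer denotes the finite sum $\sum_{j=0}^{p}\frac{(-p)_j(x)_j(y)_j}{(u)_j(v)_j\,j!}$. All formulas are understood for parameter values for which they make sense; rational expressions are read after cancellation of common factors (in particular an expression with factor $n_1=0$ in the numerator is $0$). Auxiliary functions of $(n_1,n_2,\alpha_1,\alpha_2,\beta,N)$: $$A=\frac{n_1(n_1+n_2+\alpha_2+\beta)(n_1+n_2+\beta)(N+n_1+\alpha_1+\beta+1)}{(n_1+2n_2+\alpha_2+\beta)(2n_1+n_2+\alpha_1+\beta)(2n_1+n_2+\alpha_1+\beta+1)},$$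 $$B=\frac{(n_1+\alpha_1-\alpha_2)(n_1+n_2+\alpha_1+\beta)(n_1+n_2+\beta-1)(N-n_1-n_2+1)}{(n_1+2n_2+\alpha_2+\beta-1)(2n_1+n_2+\alpha_1+\beta)(2n_1+n_2+\alpha_1+\beta-1)},$$ $$C=\frac{(n_1+\alpha_1)(n_1+n_2+\alpha_1+\beta-1)(n_1+n_2+\alpha_2+\beta-1)(N-n_1-n_2+2)}{(n_1+2n_2+\alpha_2+\beta-2)(2n_1+n_2+\alpha_1+\beta-2)(2n_1+n_2+\alpha_1+\beta-1)},$$ $$D=\frac{n_1n_2(n_1+n_2+\beta)}{(2n_1+n_2+\alpha_1+\beta+1)(n_1+2n_2+\alpha_2+\beta)}.$$ Multiple Hahn recurrence coefficients (the arguments $\beta,N$ of $A,B,C,D$ are always the same and are suppressed, so $A(n_1,n_2,x,y)$ means $A(n_1,n_2,x,y,\beta,N)$, i.e. $\alpha_1$ replaced by $x$ and $\alpha_2$ by $y$): $b_{2k}=A(k,k,\alpha_1,\alpha_2)+A(k,k,\alpha_2,\alpha_1+1)+C(k+1,k+1,\alpha_1,\alpha_2)+D(k,k,\alpha_1,\alpha_2)$; $b_{2k+1}=A(k,k+1,\alpha_2,\alpha_1)+A(k+1,k,\alpha_1,\alpha_2+1)+C(k+1,k+2,\alpha_2,\alpha_1)+D(k,k+1,\alpha_2,\alpha_1)$; $c_{2k}=\big(A(k,k,\alpha_1,\alpha_2)+A(k,k,\alpha_2,\alpha_1+1)+D(k,k,\alpha_1,\alpha_2)\big)C(k,k+1,\alpha_2,\alpha_1)+A(k,k,\alpha_1,\alpha_2)B(k,k,\alpha_1,\alpha_2)$;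 $c_{2k+1}=\big(A(k,k+1,\alpha_2,\alpha_1)+A(k+1,k,\alpha_1,\alpha_2+1)+D(k,k+1,\alpha_2,\alpha_1)\big)C(k+1,k+1,\alpha_1,\alpha_2)+A(k,k+1,\alpha_2,\alpha_1)B(k,k+1,\alpha_2,\alpha_1)$; $d_{2k}=A(k,k,\alpha_1,\alpha_2)B(k,k,\alpha_1,\alpha_2)C(k,k,\alpha_1,\alpha_2)$; $d_{2k+1}=A(k,k+1,\alpha_2,\alpha_1)B(k,k+1,\alpha_2,\alpha_1)C(k,k+1,\alpha_2,\alpha_1)$.
   Formalization: Positivity is proved for β > −1 (it fails for β ≤ −1) and for a_1,…,a_{3N} (a_{3N+1} = 0); the factorization assumes α_1+β+k ≠ 0 (2≤k≤(3N+3)/2), α_2+β+k ≠ 0 (2≤k≤(3N+2)/2) and nonzero 3F2 denominators. *)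

theory Defs
  imports Complex_Main "Jordan_Normal_Form.Matrix"
begin

text \<open>Matrices of the library are indexed from 0, so row and column \<open>i\<close> of the usual
  numbering is index \<open>i - 1\<close> here.\<close>

definition tetra_mat :: "(nat \<Rightarrow> real) \<Rightarrow> (nat \<Rightarrow> real) \<Rightarrow> (nat \<Rightarrow> real) \<Rightarrow> nat \<Rightarrow> real mat" where
  "tetra_mat b c d m = mat m m (\<lambda>(i, j).
     if i = j then b i
     else if j = i + 1 then 1
     else if i = j + 1 then c i
     else if i = j + 2 then d i
     else 0)"

definition L1_mat :: "(nat \<Rightarrow> real) \<Rightarrow> nat \<Rightarrow> real mat" where
  "L1_mat a m = mat m m (\<lambda>(i, j).
     if i = j then 1 else if i = j + 1 then a (3 * j + 2) else 0)"

definition L2_mat :: "(nat \<Rightarrow> real) \<Rightarrow> nat \<Rightarrow> real mat" where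
  "L2_mat a m = mat m m (\<lambda>(i, j).
     if i = j then 1 else if i = j + 1 then a (3 * j + 3) else 0)"

definition U_mat :: "(nat \<Rightarrow> real) \<Rightarrow> nat \<Rightarrow> real mat" where
  "U_mat a m = mat m m (\<lambda>(i, j).
     if i = j then a (3 * i + 1) else if j = i + 1 then 1 else 0)"

text \<open>Terminating hypergeometric sum at 1 with upper parameters \<open>-p\<close>, \<open>x\<close>, \<open>y\<close>
  and lower parameters \<open>u\<close>, \<open>v\<close>. Stopping at \<open>j = p\<close> matters: \<open>u\<close> may be an
  integer at most \<open>-p\<close>, for which the later terms are not defined.\<close>

definition hyp3F2 :: "nat \<Rightarrow> real \<Rightarrow> real \<Rightarrow> real \<Rightarrow> real \<Rightarrow> real" where
  "hyp3F2 p x y u v = (\<Sum>j\<le>p.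
     pochhammer (- real p) j * pochhammer x j * pochhammer y j /
     (pochhammer u j * pochhammer v j * fact j))"

text \<open>Quotient of two linear factors \<open>x + s\<close> and \<open>x + t\<close> of a rational expression, read
  after cancellation of common factors: it is used only for factors with the same \<open>x\<close> and
  with shifts \<open>s\<close>, \<open>t\<close> depending on the integer indices alone, so the two values agree
  exactly when the factors coincide and cancel, in particular at a common zero (where
  division would give 0). Elsewhere it is the ordinary quotient.

  In the expressions below a common zero that survives in admissible parameters (see
  \<open>hahn_admissible\<close>) occurs only for \<open>\<alpha>\<^sub>i + \<beta> + 1 = 0\<close>, namely in \<open>hahn_C\<close> at (1,1) and in the
  first two bidiagonal coefficients. The other cancellation required, an expression with
  numerator factor 0 having value 0, already holds for the division of the library.\<close>

definition cancel_div :: "real \<Rightarrow> real \<Rightarrow> real" where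
  "cancel_div s t = (if s = t then 1 else s / t)"

definition hahn_A :: "real \<Rightarrow> nat \<Rightarrow> nat \<Rightarrow> nat \<Rightarrow> real \<Rightarrow> real \<Rightarrow> real" where
  "hahn_A \<beta> N n1 n2 \<alpha>1 \<alpha>2 =
     real n1 * (real n1 + real n2 + \<alpha>2 + \<beta>) * (real n1 + real n2 + \<beta>)
       * (real N + real n1 + \<alpha>1 + \<beta> + 1) /
     ((real n1 + 2 * real n2 + \<alpha>2 + \<beta>) * (2 * real n1 + real n2 + \<alpha>1 + \<beta>)
       * (2 * real n1 + real n2 + \<alpha>1 + \<beta> + 1))"

definition hahn_B :: "real \<Rightarrow> nat \<Rightarrow> nat \<Rightarrow> nat \<Rightarrow> real \<Rightarrow> real \<Rightarrow> real" where
  "hahn_B \<beta> N n1 n2 \<alpha>1 \<alpha>2 =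
     (real n1 + \<alpha>1 - \<alpha>2) * (real n1 + real n2 + \<alpha>1 + \<beta>) * (real n1 + real n2 + \<beta> - 1)
       * (real N - real n1 - real n2 + 1) /
     ((real n1 + 2 * real n2 + \<alpha>2 + \<beta> - 1) * (2 * real n1 + real n2 + \<alpha>1 + \<beta>)
       * (2 * real n1 + real n2 + \<alpha>1 + \<beta> - 1))"

definition hahn_C :: "real \<Rightarrow> nat \<Rightarrow> nat \<Rightarrow> nat \<Rightarrow> real \<Rightarrow> real \<Rightarrow> real" where
  "hahn_C \<beta> N n1 n2 \<alpha>1 \<alpha>2 =
     cancel_div (real n1 + real n2 + \<alpha>1 + \<beta> - 1) (2 * real n1 + real n2 + \<alpha>1 + \<beta> - 2)
     * cancel_div (real n1 + real n2 + \<alpha>2 + \<beta> - 1) (real n1 + 2 * real n2 + \<alpha>2 + \<beta> - 2)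
     * ((real n1 + \<alpha>1) * (real N - real n1 - real n2 + 2) /
        (2 * real n1 + real n2 + \<alpha>1 + \<beta> - 1))"

definition hahn_D :: "real \<Rightarrow> nat \<Rightarrow> nat \<Rightarrow> nat \<Rightarrow> real \<Rightarrow> real \<Rightarrow> real" where
  "hahn_D \<beta> N n1 n2 \<alpha>1 \<alpha>2 =
     real n1 * real n2 * (real n1 + real n2 + \<beta>) /
     ((2 * real n1 + real n2 + \<alpha>1 + \<beta> + 1) * (real n1 + 2 * real n2 + \<alpha>2 + \<beta>))"

definition hahn_b :: "nat \<Rightarrow> real \<Rightarrow> real \<Rightarrow> real \<Rightarrow> nat \<Rightarrow> real" where
  "hahn_b N \<alpha>1 \<alpha>2 \<beta> n =
     (let k = n div 2; A = hahn_A \<beta> N; C = hahn_C \<beta> N; D = hahn_D \<beta> N in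
      if even n then
        A k k \<alpha>1 \<alpha>2 + A k k \<alpha>2 (\<alpha>1 + 1) + C (k + 1) (k + 1) \<alpha>1 \<alpha>2 + D k k \<alpha>1 \<alpha>2
      else
        A k (k + 1) \<alpha>2 \<alpha>1 + A (k + 1) k \<alpha>1 (\<alpha>2 + 1) + C (k + 1) (k + 2) \<alpha>2 \<alpha>1
        + D k (k + 1) \<alpha>2 \<alpha>1)"

definition hahn_c :: "nat \<Rightarrow> real \<Rightarrow> real \<Rightarrow> real \<Rightarrow> nat \<Rightarrow> real" where
  "hahn_c N \<alpha>1 \<alpha>2 \<beta> n =
     (let k = n div 2; A = hahn_A \<beta> N; B = hahn_B \<beta> N; C = hahn_C \<beta> N; D = hahn_D \<beta> N in
      if even n then
        (A k k \<alpha>1 \<alpha>2 + A k k \<alpha>2 (\<alpha>1 + 1) + D k k \<alpha>1 \<alpha>2) * C k (k + 1) \<alpha>2 \<alpha>1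
        + A k k \<alpha>1 \<alpha>2 * B k k \<alpha>1 \<alpha>2
      else
        (A k (k + 1) \<alpha>2 \<alpha>1 + A (k + 1) k \<alpha>1 (\<alpha>2 + 1) + D k (k + 1) \<alpha>2 \<alpha>1)
          * C (k + 1) (k + 1) \<alpha>1 \<alpha>2
        + A k (k + 1) \<alpha>2 \<alpha>1 * B k (k + 1) \<alpha>2 \<alpha>1)"

definition hahn_d :: "nat \<Rightarrow> real \<Rightarrow> real \<Rightarrow> real \<Rightarrow> nat \<Rightarrow> real" where
  "hahn_d N \<alpha>1 \<alpha>2 \<beta> n =
     (let k = n div 2; A = hahn_A \<beta> N; B = hahn_B \<beta> N; C = hahn_C \<beta> N in
      if even n then A k k \<alpha>1 \<alpha>2 * B k k \<alpha>1 \<alpha>2 * C k k \<alpha>1 \<alpha>2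
      else A k (k + 1) \<alpha>2 \<alpha>1 * B k (k + 1) \<alpha>2 \<alpha>1 * C k (k + 1) \<alpha>2 \<alpha>1)"

text \<open>\<open>hahn_a1\<close>, \dots, \<open>hahn_a6\<close> at \<open>n\<close> are the bidiagonal coefficients of index
  \<open>6n + 1\<close>, \dots, \<open>6n + 6\<close>.\<close>

definition hahn_a1 :: "nat \<Rightarrow> real \<Rightarrow> real \<Rightarrow> real \<Rightarrow> nat \<Rightarrow> real" where
  "hahn_a1 N \<alpha>1 \<alpha>2 \<beta> n =
     cancel_div (\<alpha>1 + \<beta> + 2 * real n + 1) (\<alpha>1 + \<beta> + 3 * real n + 1)
     * cancel_div (\<alpha>2 + \<beta> + 2 * real n + 1) (\<alpha>2 + \<beta> + 3 * real n + 1)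
     * ((real N - 2 * real n) * (\<alpha>1 + 1 + real n) / (\<alpha>1 + \<beta> + 3 * real n + 2))"

definition hahn_a2 :: "nat \<Rightarrow> real \<Rightarrow> real \<Rightarrow> real \<Rightarrow> nat \<Rightarrow> real" where
  "hahn_a2 N \<alpha>1 \<alpha>2 \<beta> n =
     cancel_div (\<alpha>2 + \<beta> + real n + 1) (\<alpha>2 + \<beta> + 3 * real n + 1)
     * ((real N - 2 * real n) * pochhammer (real n) n * (\<beta> + 2 * real n + 1)
          * (\<alpha>2 - \<alpha>1 + real n) /
        (pochhammer (real n + 1) n * (\<alpha>1 + \<beta> + 3 * real n + 2)
          * (\<alpha>2 + \<beta> + 3 * real n + 2)))
     * (hyp3F2 n (- real N) (\<alpha>2 - \<alpha>1 - real n) (- 2 * real n + 1) (\<alpha>2 + \<beta> + real n + 1) /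
        hyp3F2 n (- real N) (\<alpha>2 - \<alpha>1 - real n) (- 2 * real n) (\<alpha>2 + \<beta> + real n + 2))"

definition hahn_a3 :: "nat \<Rightarrow> real \<Rightarrow> real \<Rightarrow> real \<Rightarrow> nat \<Rightarrow> real" where
  "hahn_a3 N \<alpha>1 \<alpha>2 \<beta> n =
     (2 * real n + 1) * (\<beta> + 2 * real n + 1) * (\<alpha>1 + \<beta> + 2 * real n + 2)
       * (\<alpha>2 + \<beta> + 2 * real n + 2) /
     (pochhammer (\<alpha>1 + \<beta> + 3 * real n + 2) 2 * (\<alpha>2 + \<beta> + 3 * real n + 2))
     * (hyp3F2 (n + 1) (- real N) (\<alpha>2 - \<alpha>1 - real n - 1) (- 2 * real n - 1)
          (\<alpha>2 + \<beta> + real n + 2) /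
        hyp3F2 n (- real N) (\<alpha>2 - \<alpha>1 - real n) (- 2 * real n) (\<alpha>2 + \<beta> + real n + 2))"

definition hahn_a4 :: "nat \<Rightarrow> real \<Rightarrow> real \<Rightarrow> real \<Rightarrow> nat \<Rightarrow> real" where
  "hahn_a4 N \<alpha>1 \<alpha>2 \<beta> n =
     (real N - 2 * real n - 1) * (\<alpha>2 + 1 + real n) * (\<alpha>1 + \<beta> + 2 * real n + 2)
       * (\<alpha>2 + \<beta> + 2 * real n + 2) /
     ((\<alpha>1 + \<beta> + 3 * real n + 3) * pochhammer (\<alpha>2 + \<beta> + 3 * real n + 2) 2)"

definition hahn_a5 :: "nat \<Rightarrow> real \<Rightarrow> real \<Rightarrow> real \<Rightarrow> nat \<Rightarrow> real" where
  "hahn_a5 N \<alpha>1 \<alpha>2 \<beta> n =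
     (real n + 1) * (real N - 2 * real n - 1) * (\<beta> + 2 * real n + 2)
       * (\<alpha>1 - \<alpha>2 + real n + 1) * (\<alpha>1 + \<beta> + 2 + real n + real N) /
     ((2 * real n + 1) * pochhammer (\<alpha>1 + \<beta> + 3 * real n + 3) 2
       * (\<alpha>2 + \<beta> + 3 * real n + 3))
     * (hyp3F2 n (- real N) (\<alpha>2 - \<alpha>1 - real n) (- 2 * real n) (\<alpha>2 + \<beta> + real n + 2) /
        hyp3F2 (n + 1) (- real N) (\<alpha>2 - \<alpha>1 - real n - 1) (- 2 * real n - 1)
          (\<alpha>2 + \<beta> + real n + 2))"

definition hahn_a6 :: "nat \<Rightarrow> real \<Rightarrow> real \<Rightarrow> real \<Rightarrow> nat \<Rightarrow> real" where
  "hahn_a6 N \<alpha>1 \<alpha>2 \<beta> n =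
     2 * (real n + 1) * (\<beta> + 2 * real n + 2) * (\<alpha>1 + \<beta> + 2 * real n + 3)
       * (\<alpha>2 + \<beta> + 2 * real n + 3) * (\<alpha>2 + \<beta> + 2 + real n + real N) /
     ((\<alpha>1 + \<beta> + 3 * real n + 4) * pochhammer (\<alpha>2 + \<beta> + 3 * real n + 3) 2
       * (\<alpha>2 + \<beta> + real n + 2))
     * (hyp3F2 (n + 1) (- real N) (\<alpha>2 - \<alpha>1 - real n - 1) (- 2 * real n - 2)
          (\<alpha>2 + \<beta> + real n + 3) /
        hyp3F2 (n + 1) (- real N) (\<alpha>2 - \<alpha>1 - real n - 1) (- 2 * real n - 1)
          (\<alpha>2 + \<beta> + real n + 2))"

text \<open>The sequence starts at index 1; the value at 0 is irrelevant.\<close>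

definition hahn_a :: "nat \<Rightarrow> real \<Rightarrow> real \<Rightarrow> real \<Rightarrow> nat \<Rightarrow> real" where
  "hahn_a N \<alpha>1 \<alpha>2 \<beta> i =
     (let n = (i - 1) div 6; r = (i - 1) mod 6 in
      if r = 0 then hahn_a1 N \<alpha>1 \<alpha>2 \<beta> n
      else if r = 1 then hahn_a2 N \<alpha>1 \<alpha>2 \<beta> n
      else if r = 2 then hahn_a3 N \<alpha>1 \<alpha>2 \<beta> n
      else if r = 3 then hahn_a4 N \<alpha>1 \<alpha>2 \<beta> n
      else if r = 4 then hahn_a5 N \<alpha>1 \<alpha>2 \<beta> n
      else hahn_a6 N \<alpha>1 \<alpha>2 \<beta> n)"

text \<open>Parameter values for which the formulas make sense: no denominator that remains after
  cancellation vanishes in any entry of the matrices of size up to \<open>N + 1\<close>. The linear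
  factors remaining in those denominators are the \<open>\<alpha>\<^sub>1 + \<beta> + k\<close> and \<open>\<alpha>\<^sub>2 + \<beta> + k\<close> listed in the
  first two conditions; they do not vanish when \<open>\<alpha>\<^sub>1\<close>, \<open>\<alpha>\<^sub>2\<close>, \<open>\<beta>\<close> all exceed -1. The last two
  conditions concern the hypergeometric denominators of the coefficients of index \<open>6n + 2\<close>,
  \<open>6n + 3\<close> (occurring for \<open>2n + 1 \<le> N\<close>), respectively \<open>6n + 5\<close>, \<open>6n + 6\<close> (occurring for
  \<open>2n + 2 \<le> N\<close>).\<close>

definition hahn_admissible :: "nat \<Rightarrow> real \<Rightarrow> real \<Rightarrow> real \<Rightarrow> bool" where
  "hahn_admissible N \<alpha>1 \<alpha>2 \<beta> \<longleftrightarrow>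
     (\<forall>k\<in>{2..(3 * N + 3) div 2}. \<alpha>1 + \<beta> + real k \<noteq> 0) \<and>
     (\<forall>k\<in>{2..(3 * N + 2) div 2}. \<alpha>2 + \<beta> + real k \<noteq> 0) \<and>
     (\<forall>n. 2 * n + 1 \<le> N \<longrightarrow>
        hyp3F2 n (- real N) (\<alpha>2 - \<alpha>1 - real n) (- 2 * real n) (\<alpha>2 + \<beta> + real n + 2) \<noteq> 0) \<and>
     (\<forall>n. 2 * n + 2 \<le> N \<longrightarrow>
        hyp3F2 (n + 1) (- real N) (\<alpha>2 - \<alpha>1 - real n - 1) (- 2 * real n - 1)
          (\<alpha>2 + \<beta> + real n + 2) \<noteq> 0)"

abbreviation hahn_T :: "nat \<Rightarrow> real \<Rightarrow> real \<Rightarrow> real \<Rightarrow> nat \<Rightarrow> real mat" where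
  "hahn_T N \<alpha>1 \<alpha>2 \<beta> m \<equiv>
     tetra_mat (hahn_b N \<alpha>1 \<alpha>2 \<beta>) (hahn_c N \<alpha>1 \<alpha>2 \<beta>) (hahn_d N \<alpha>1 \<alpha>2 \<beta>) m"

text \<open>The factorizations use only the coefficients of index at most \<open>3N + 1\<close>, and the last
  of these (the bottom diagonal entry of \<open>U\<close> of size \<open>N + 1\<close>) carries the factor
  \<open>N - 2n = 0\<close> or \<open>N - 2n - 1 = 0\<close>. Hence positivity concerns the indices from 1 to \<open>3N\<close>.\<close>

definition hahn_a_positive :: "nat \<Rightarrow> real \<Rightarrow> real \<Rightarrow> real \<Rightarrow> bool" where
  "hahn_a_positive N \<alpha>1 \<alpha>2 \<beta> \<longleftrightarrow> (\<forall>i\<in>{1..3 * N}. hahn_a N \<alpha>1 \<alpha>2 \<beta> i > 0)"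

end

theory Submission
  imports Defs
begin

text \<open>Write \<open>\<delta> = \<alpha>\<^sub>2 - \<alpha>\<^sub>1\<close>, \<open>\<gamma> = \<alpha>\<^sub>2 + \<beta>\<close>. All hypergeometric sums in the bidiagonal coefficients are
  values of \<open>F\<^sub>k = \<^sub>3F\<^sub>2(-k, -N, \<delta> - k; -2k, \<gamma> + k + 2)\<close> and
  \<open>H\<^sub>k = \<^sub>3F\<^sub>2(-k, -N, \<delta> - k; -2k + 1, \<gamma> + k + 1)\<close>. Comparing entries in \<open>T = L\<^sub>1 L\<^sub>2 U\<close>, the factors \<open>C\<close> are
  exactly the diagonal of \<open>U\<close>, the products \<open>A B\<close> are products of two coefficients in which
  \<open>F\<close> and \<open>H\<close> cancel, and what remains are two contiguous relations, one between
  \<open>H\<^sub>k, F\<^sub>k\<^sub>-\<^sub>1, F\<^sub>k\<close> and one between \<open>F\<^sub>k, H\<^sub>k, H\<^sub>k\<^sub>+\<^sub>1\<close>. Both follow by creative telescoping.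
  In the semi-band each factor \<open>(-k)\<^sub>j\<close>, \<open>(-N)\<^sub>j\<close>, \<open>(\<delta> - k)\<^sub>j\<close>, \<open>(-2k)\<^sub>j\<close> has sign \<open>(-1)\<^sup>j\<close>, so that all
  terms of the sums are nonnegative.\<close>

section \<open>Contiguous relations\<close>

definition hyp_term :: "nat \<Rightarrow> real \<Rightarrow> real \<Rightarrow> real \<Rightarrow> real \<Rightarrow> nat \<Rightarrow> real" where
  "hyp_term p x y u v j =
     pochhammer (- real p) j * pochhammer x j * pochhammer y j /
     (pochhammer u j * pochhammer v j * fact j)"

lemma hyp3F2_eq_sum_hyp_term: "hyp3F2 p x y u v = (\<Sum>j\<le>p. hyp_term p x y u v j)"
  by (simp add: hyp3F2_def hyp_term_def)

lemma hyp_term_0 [simp]: "hyp_term p x y u v 0 = 1"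
  by (simp add: hyp_term_def)

text \<open>Lets series of different length be summed over one range, and kills the upper boundary
  term of the telescoping sums.\<close>

lemma hyp_term_eq_0: "p < j \<Longrightarrow> hyp_term p x y u v j = 0"
  by (simp add: hyp_term_def pochhammer_of_nat_eq_0_iff)

text \<open>The term ratio in cleared form; it is what reduces a telescoping equation to a
  polynomial identity.\<close>

lemma hyp_term_Suc:
  assumes "u + real j \<noteq> 0" "v + real j \<noteq> 0"
  shows "hyp_term p x y u v (Suc j) * ((u + real j) * (v + real j) * (real j + 1)) =
    hyp_term p x y u v j * ((real j - real p) * (x + real j) * (y + real j))"
  using assms unfolding hyp_term_def pochhammer_Suc fact_Suc by (simp add: divide_simps)

lemma pochhammer_shift: "x * pochhammer (x + 1) j = pochhammer x j * (x + real j)" for x :: real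
  by (metis pochhammer_rec pochhammer_Suc)

text \<open>\<open>pochhammer_shift\<close> in three parameters at once. It links the summands of
  \<open>F\<^sub>k\<^sub>-\<^sub>1\<close> and \<open>H\<^sub>k\<close>, and is multiplied through
  because \<open>y\<close> may vanish.\<close>

lemma hyp_term_dec_p_y_u:
  assumes "pochhammer u j \<noteq> 0" "u \<noteq> 0" "u + real j \<noteq> 0"
  shows "(real p + 1) * y * hyp_term p x (y + 1) (u + 1) v j * (u + real j) =
    hyp_term (Suc p) x y u v j * u * (real p + 1 - real j) * (y + real j)"
proof -
  have 1: "(real p + 1) * pochhammer (- real p) j =
      pochhammer (- real (Suc p)) j * (real p + 1 - real j)"
    using pochhammer_shift[of "- real (Suc p)" j] by (simp add: algebra_simps)
  have 2: "y * pochhammer (y + 1) j = pochhammer y j * (y + real j)"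
    by (rule pochhammer_shift)
  have 3: "pochhammer (u + 1) j = pochhammer u j * (u + real j) / u"
    using pochhammer_shift[of u j] assms by (simp add: field_simps)
  have "(real p + 1) * y * hyp_term p x (y + 1) (u + 1) v j * (u + real j) =
     (((real p + 1) * pochhammer (- real p) j) * (y * pochhammer (y + 1) j)) * pochhammer x j
      * (u + real j) / (pochhammer (u + 1) j * pochhammer v j * fact j)"
    by (simp add: hyp_term_def)
  also have "\<dots> = hyp_term (Suc p) x y u v j * u * (real p + 1 - real j) * (y + real j)"
    unfolding 1 2 3 hyp_term_def using assms by (simp add: divide_simps)
  finally show ?thesis .
qed

text \<open>Links the summands of \<open>F\<^sub>k\<close> and \<open>H\<^sub>k\<close>, whose lower
  parameters differ by shifts in opposite directions.\<close>

lemma hyp_term_shift_u_v: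
  assumes "pochhammer u j \<noteq> 0" "u - 1 \<noteq> 0" "u - 1 + real j \<noteq> 0" "v \<noteq> 0" "v + real j \<noteq> 0"
  shows "hyp_term p x y (u - 1) (v + 1) j * (u - 1) * (v + real j) =
    hyp_term p x y u v j * (u - 1 + real j) * v"
proof -
  have 1: "(u - 1) * pochhammer u j = pochhammer (u - 1) j * (u - 1 + real j)"
    using pochhammer_shift[of "u - 1" j] by simp
  have 2: "v * pochhammer (v + 1) j = pochhammer v j * (v + real j)"
    by (rule pochhammer_shift)
  have u: "pochhammer (u - 1) j = (u - 1) * pochhammer u j / (u - 1 + real j)"
    using 1 assms by (simp add: field_simps)
  have v: "pochhammer (v + 1) j = pochhammer v j * (v + real j) / v"
    using 2 assms by (simp add: field_simps)
  show ?thesis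
    unfolding hyp_term_def u v using assms by (simp add: divide_simps)
qed

text \<open>Splitting off the first factor for the three shifted parameters, and the last factor for
  \<open>x\<close> and \<open>v\<close>, makes summand \<open>j + 1\<close> of
  \<open>H\<^sub>k\<^sub>+\<^sub>1\<close> meet summand \<open>j\<close> of
  \<open>F\<^sub>k\<close>.\<close>

lemma hyp_term_Suc_dec_p_y_u:
  assumes "u \<noteq> 0" "v + real j \<noteq> 0"
  shows "hyp_term (Suc p) x y u v (Suc j) * (u * (v + real j) * (real j + 1)) =
    - (hyp_term p x (y + 1) (u + 1) v j * ((real p + 1) * y * (x + real j)))"
  unfolding hyp_term_def pochhammer_rec[of "- real (Suc p)"] pochhammer_rec[of y]
    pochhammer_rec[of u] pochhammer_Suc[of x] pochhammer_Suc[of v] fact_Suc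
  using assms by (simp add: divide_simps) (simp add: algebra_simps)

section \<open>The two families of sums and their contiguous relations by telescoping\<close>

definition hypF :: "real \<Rightarrow> real \<Rightarrow> real \<Rightarrow> nat \<Rightarrow> real" where
  "hypF N \<delta> \<gamma> k = hyp3F2 k (- N) (\<delta> - real k) (- 2 * real k) (\<gamma> + real k + 2)"

definition hypH :: "real \<Rightarrow> real \<Rightarrow> real \<Rightarrow> nat \<Rightarrow> real" where
  "hypH N \<delta> \<gamma> k = hyp3F2 k (- N) (\<delta> - real k) (- 2 * real k + 1) (\<gamma> + real k + 1)"

lemma pochhammer_neq_0:
  assumes "\<And>i. i < n \<Longrightarrow> x + real i \<noteq> 0"
  shows "pochhammer x n \<noteq> (0::real)"
  using assms unfolding pochhammer_prod by auto

text \<open>What remains of the identity \<open>hahn_A_D_eq_a5_a6\<close> once denominators are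
  cleared. The sum telescopes to 0: \<open>h 0 = 0\<close> by the factor \<open>j\<close>, and
  \<open>h (n + 2) = 0\<close> because \<open>t\<close> has run out.\<close>

lemma hypH_rel:
  fixes N \<sigma> \<gamma> :: real and n :: nat
  defines "k \<equiv> real n + 1" and "\<delta> \<equiv> \<gamma> - \<sigma>"
  assumes ne: "\<And>i. i \<in> {n + 2..2 * n + 3} \<Longrightarrow> \<gamma> + real i \<noteq> 0"
  shows "((2*k+\<gamma>)*(N+k+\<sigma>+1)*(3*k+\<gamma>+1) + (2*k+\<sigma>+1)*(N+k+\<gamma>+1)*(3*k+\<sigma>)
      + k*(3*k+\<sigma>)*(3*k+\<gamma>+1)) * hypH N \<delta> \<gamma> (n + 1) =
    (N-2*k+1)*(k-\<delta>)*(\<sigma>+1+k+N)*(3*k+\<gamma>+1)/(2*k-1) * hypF N \<delta> \<gamma> n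
    + 2*(\<sigma>+2*k+1)*(\<gamma>+2*k+1)*(\<gamma>+1+k+N)*(3*k+\<sigma>)/(\<gamma>+k+1) * hypF N \<delta> \<gamma> (n + 1)"
    (is "?P * _ = ?X * _ + ?Z * _")
proof -
  define P X Z where "P = ?P" and "X = ?X" and "Z = ?Z"
  \<comment> \<open>\<open>Y\<close> and \<open>W\<close> are what is left of \<open>X\<close> and
    \<open>Z\<close> after the factors \<open>\<delta>-k\<close>, \<open>2*k-1\<close> and
    \<open>\<gamma>+k+1\<close> have cancelled against the ratios \<open>f j / t j\<close> and
    \<open>f' j / t j\<close>.\<close>
  define Y where "Y = (N-2*k+1)*(\<sigma>+1+k+N)*(3*k+\<gamma>+1)"
  define W where "W = (\<sigma>+2*k+1)*(\<gamma>+2*k+1)*(\<gamma>+1+k+N)*(3*k+\<sigma>)"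
  define t where "t = hyp_term (n+1) (-N) (\<delta>-k) (-2*k+1) (\<gamma>+k+1)"
  define f where "f = hyp_term n (-N) (\<delta>-k+1) (-2*k+2) (\<gamma>+k+1)"
  define f' where "f' = hyp_term (n+1) (-N) (\<delta>-k) (-2*k) (\<gamma>+k+2)"
  define y where "y j = -(3*k+\<gamma>+1)*((\<sigma>+1+k+N)*(\<gamma>+3*k) + (N-2*k+1)*(j-2*k))" for j :: real
  \<comment> \<open>In the telescoping equation for \<open>h\<close> below, the coefficient of \<open>j\<^sup>3\<close> gives the slope of \<open>y\<close>
    and the pole at \<open>j = 2k - 1\<close> gives \<open>y (2k)\<close>.\<close>
  define h where "h j = real j * y (real j) * t j" for j
  have k: "k \<ge> 1" by (simp add: k_def)
  have g0: "\<gamma>+k+1 \<noteq> 0" using ne[of "n+2"] by (simp add: k_def algebra_simps)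
  have X: "X = - Y * (\<delta>-k) / (2*k-1)" unfolding X_def Y_def using k by (simp add: divide_simps) (simp add: algebra_simps)
  have Z: "Z = 2 * W / (\<gamma>+k+1)" by (simp add: Z_def W_def)
  \<comment> \<open>The factor \<open>k\<close> clears the \<open>k\<close> in the denominators of
    both \<open>f j / t j\<close> and \<open>f' j / t j\<close>.\<close>
  have step: "k * (P * t j - X * f j - Z * f' j) = h (Suc j) - h j" if j: "j \<le> n + 1" for j
  proof -
    define J where "J = real j"
    have gj: "\<gamma>+k+1+J \<noteq> 0"
      using ne[of "n+2+j"] j by (simp add: k_def J_def algebra_simps)
    have poch: "pochhammer (-2*k+1) j \<noteq> 0"
      by (rule pochhammer_neq_0) (use j in \<open>auto simp: k_def\<close>)
    have f': "f' j * (k * (\<gamma>+k+1+J)) = t j * ((2*k-J) * (\<gamma>+k+1)) / 2"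
      using hyp_term_shift_u_v[of "-2*k+1" j "\<gamma>+k+1" "n+1" "-N" "\<delta>-k"] poch g0 gj j k
      by (simp add: t_def f'_def J_def k_def algebra_simps)
    have Zf': "k * (Z * f' j) * (\<gamma>+k+1+J) = t j * (2*k-J) * W"
    proof -
      have "k * (Z * f' j) * (\<gamma>+k+1+J) = Z * (f' j * (k * (\<gamma>+k+1+J)))" by simp
      also have "\<dots> = t j * (2*k-J) * W"
        unfolding f' Z using g0 by (simp add: divide_simps)
      finally show ?thesis .
    qed
    show ?thesis
    proof (cases "j = n + 1") \<comment> \<open>separate, because \<open>j - 2k + 1 = 0\<close> there when \<open>k = 1\<close>\<close>
      case False
      hence j: "j \<le> n" using j by simp
      have d1: "J-2*k+1 \<noteq> 0" using j by (simp add: J_def k_def)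
      have t': "t (Suc j) * ((J-2*k+1)*(\<gamma>+k+1+J)*(J+1)) = t j * ((J-k)*(J-N)*(J+\<delta>-k))"
        using hyp_term_Suc[of "-2*k+1" j "\<gamma>+k+1" "n+1" "-N" "\<delta>-k"] d1 gj
        by (simp add: t_def J_def k_def algebra_simps)
      have f: "k*(\<delta>-k)* f j * (J-2*k+1) = t j * (-2*k+1)*(k-J)*(J+\<delta>-k)"
        using hyp_term_dec_p_y_u[of "-2*k+1" j n "\<delta>-k" "-N" "\<gamma>+k+1"] poch d1 k
        by (simp add: t_def f_def J_def k_def algebra_simps)
      have Xf: "k * (X * f j) * (J-2*k+1) = t j * Y * (k-J)*(J+\<delta>-k)"
      proof -
        have "k * (X * f j) * (J-2*k+1) = - Y / (2*k-1) * (k*(\<delta>-k)* f j * (J-2*k+1))"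
          by (simp add: X)
        also have "\<dots> = t j * Y * (k-J)*(J+\<delta>-k)"
          unfolding f using k by (simp add: divide_simps) Groebner_Basis.algebra
        finally show ?thesis .
      qed
      have "k * (P * t j - X * f j - Z * f' j) * ((J-2*k+1)*(\<gamma>+k+1+J))
        = k * P * t j * ((J-2*k+1)*(\<gamma>+k+1+J)) - (k * (X * f j) * (J-2*k+1)) * (\<gamma>+k+1+J)
        - (k * (Z * f' j) * (\<gamma>+k+1+J)) * (J-2*k+1)"
        by (simp only: algebra_simps)
      \<comment> \<open>Everything is now a multiple of \<open>t j\<close>, so this is the
        polynomial identity that \<open>y\<close> was chosen to satisfy.\<close>
      also have "\<dots> = y (J+1) * (t j * ((J-k)*(J-N)*(J+\<delta>-k))) - J * y J * t j * ((J-2*k+1)*(\<gamma>+k+1+J))"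
        unfolding Xf Zf' P_def Y_def W_def y_def \<delta>_def by Groebner_Basis.algebra
      also have "\<dots> = ((J+1) * y (J+1) * t (Suc j) - J * y J * t j) * ((J-2*k+1)*(\<gamma>+k+1+J))"
        unfolding t'[symmetric] by Groebner_Basis.algebra
      also have "(J+1) * y (J+1) * t (Suc j) - J * y J * t j = h (Suc j) - h j"
        by (simp add: h_def J_def add.commute)
      finally show ?thesis using d1 gj by simp
    next
      case True
      have J: "J = k" using True by (simp add: J_def k_def)
      have 0: "h (Suc j) = 0" "f j = 0" 
        using True by (auto simp: h_def t_def f_def hyp_term_eq_0)
      have "k * (P * t j - X * f j - Z * f' j) * (\<gamma>+k+1+J) = 
        k * P * t j * (\<gamma>+k+1+J) - (k * (Z * f' j) * (\<gamma>+k+1+J))"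
        unfolding 0 by (simp only: algebra_simps mult_zero_right)
      also have "\<dots> = - (k * y k * t j) * (\<gamma>+k+1+J)"
        unfolding Zf' unfolding P_def W_def y_def \<delta>_def J by Groebner_Basis.algebra
      also have "\<dots> = (h (Suc j) - h j) * (\<gamma>+k+1+J)"
        unfolding 0 by (simp add: h_def J_def[symmetric] J)
      finally show ?thesis using gj by simp
    qed
  qed
  have "(\<Sum>j\<le>n+1. k * (P * t j - X * f j - Z * f' j)) = (\<Sum>j<n+2. h (Suc j) - h j)"
    by (rule sum.cong) (use step in auto)
  also have "\<dots> = 0"
    unfolding sum_lessThan_telescope by (simp add: h_def t_def hyp_term_eq_0)
  finally have "k * (P * (\<Sum>j\<le>n+1. t j) - X * (\<Sum>j\<le>n+1. f j) - Z * (\<Sum>j\<le>n+1. f' j)) = 0"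
    by (simp only: sum_distrib_left[symmetric] sum_subtractf)
  hence "P * (\<Sum>j\<le>n+1. t j) = X * (\<Sum>j\<le>n+1. f j) + Z * (\<Sum>j\<le>n+1. f' j)"
    using k by (simp only: mult_eq_0_iff) linarith
  \<comment> \<open>The series for \<open>F\<^sub>k\<^sub>-\<^sub>1\<close> is one summand shorter;
    its summand at \<open>n + 1\<close> is 0.\<close>
  moreover have "(\<Sum>j\<le>n+1. f j) = hypF N \<delta> \<gamma> n"
    by (simp add: hypF_def hyp3F2_eq_sum_hyp_term f_def hyp_term_eq_0 k_def algebra_simps)
  moreover have "(\<Sum>j\<le>n+1. t j) = hypH N \<delta> \<gamma> (n+1)"
    unfolding hypH_def hyp3F2_eq_sum_hyp_term t_def k_def by (simp add: algebra_simps)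
  moreover have "(\<Sum>j\<le>n+1. f' j) = hypF N \<delta> \<gamma> (n+1)"
    unfolding hypF_def hyp3F2_eq_sum_hyp_term f'_def k_def by (simp add: algebra_simps)
  ultimately show ?thesis unfolding P_def X_def Z_def by metis
qed

text \<open>The telescoping equation of \<open>hypF_rel\<close> after division by the summand and
  clearing of denominators; \<open>s\<close>, \<open>g\<close>, \<open>g - s\<close> stand for
  \<sigma>, \<gamma>, \<delta>. Isolating it leaves a pure polynomial identity.\<close>

lemma hypF_certificate:
  fixes k N s g J :: real
  defines "y \<equiv> \<lambda>j. - (3*k+1+g)*((2*k+1)*(s+2*k+2)*(g+2*k+2)
      + j*(k*(s+2*k+2)+(k+1)*(g+2*k+2)+k*(k+1)))"
  shows "(k*(2*k+1+s)*(N+k+g+1)*(3*k+3+s) + (k+1)*(2*k+2+g)*(N+k+s+2)*(3*k+1+g)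
        + k*(k+1)*(3*k+3+s)*(3*k+1+g)) * ((J-2*k)*(g+k+2+J)*(J+1))
      + k*(g+k+1+J)*((N-2*k)*(g-s+k)*(s+3*k+3))*((g+k+2+J)*(J+1))
      - (s+2*k+2)*(g+2*k+2)*(3*k+1+g) * ((k+1)*(g-s-k-1)*(J-N)) * (J-2*k) =
    y (J+1) * ((J-k)*(J-N)*(J+(g-s)-k)) - y J * ((J-2*k)*(g+k+2+J)*(J+1))"
  unfolding y_def by Groebner_Basis.algebra

text \<open>What remains of \<open>hahn_A_D_eq_a2_a3\<close> for positive index once denominators
  are cleared. The bound \<open>n \<ge> 1\<close> keeps \<open>2*k - j\<close> away from 0 for
  \<open>j \<le> n\<close>.\<close>

lemma hypF_rel:
  fixes N \<sigma> \<gamma> :: real and n :: nat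
  defines "k \<equiv> real n" and "\<delta> \<equiv> \<gamma> - \<sigma>"
  assumes n: "n \<ge> 1" and ne: "\<And>i. i \<in> {n + 1..2 * n + 2} \<Longrightarrow> \<gamma> + real i \<noteq> 0"
  shows "(k*(2*k+1+\<sigma>)*(N+k+\<gamma>+1)*(3*k+3+\<sigma>) + (k+1)*(2*k+2+\<gamma>)*(N+k+\<sigma>+2)*(3*k+1+\<gamma>)
      + k*(k+1)*(3*k+3+\<sigma>)*(3*k+1+\<gamma>)) * hypF N \<delta> \<gamma> n =
    (\<gamma>+k+1)*(N-2*k)*(\<delta>+k)/2*(\<sigma>+3*k+3) * hypH N \<delta> \<gamma> n
    + (2*k+1)*(\<sigma>+2*k+2)*(\<gamma>+2*k+2)*(3*k+1+\<gamma>) * hypH N \<delta> \<gamma> (n + 1)"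
    (is "?P * _ = ?Q * _ + ?M * _")
proof -
  define P Q M where "P = ?P" and "Q = ?Q" and "M = ?M"
  \<comment> \<open>The factor \<open>2*k+1\<close> of \<open>M\<close> is the one that cancels the
    denominator of \<open>t' (Suc j) / f j\<close>.\<close>
  define M' where "M' = (\<sigma>+2*k+2)*(\<gamma>+2*k+2)*(3*k+1+\<gamma>)"
  have M': "M = (2*k+1) * M'" by (simp add: M_def M'_def)
  define f where "f = hyp_term n (-N) (\<delta>-k) (-2*k) (\<gamma>+k+2)"
  define t where "t = hyp_term n (-N) (\<delta>-k) (-2*k+1) (\<gamma>+k+1)"
  define t' where "t' = hyp_term (n+1) (-N) (\<delta>-k-1) (-2*k-1) (\<gamma>+k+2)"
  define y where "y j = -(3*k+1+\<gamma>)*((2*k+1)*(\<sigma>+2*k+2)*(\<gamma>+2*k+2)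
      + j*(k*(\<sigma>+2*k+2)+(k+1)*(\<gamma>+2*k+2)+k*(k+1)))" for j :: real
  \<comment> \<open>Here \<open>y 0 = - M\<close>, so the boundary term of the telescoping sum supplies the term \<open>j = 0\<close> of
    \<open>H\<^sub>k\<^sub>+\<^sub>1\<close>; the pole at \<open>j = 2k\<close> fixes the slope.\<close>
  define h where "h j = y (real j) * f j" for j
  have k: "k \<ge> 1" using n by (simp add: k_def)
  have g0: "\<gamma>+k+1 \<noteq> 0" using ne[of "n+1"] n by (simp add: k_def algebra_simps)
  \<comment> \<open>The summands of \<open>H\<^sub>k\<^sub>+\<^sub>1\<close> enter shifted by one,
    since that series has one summand more.\<close>
  have step: "P * f j - Q * t j - M * t' (Suc j) = h (Suc j) - h j" if j: "j \<le> n" for j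
  proof -
    define J where "J = real j"
    have gj: "\<gamma>+k+1+J \<noteq> 0" "\<gamma>+k+2+J \<noteq> 0"
      using ne[of "n+1+j"] ne[of "n+2+j"] j by (simp_all add: k_def J_def algebra_simps)
    have d: "2*k - J \<noteq> 0" "J + 1 \<noteq> 0" using j k by (auto simp: k_def J_def)
    have poch: "pochhammer (-2*k+1) j \<noteq> 0"
      by (rule pochhammer_neq_0) (use j k in \<open>auto simp: k_def\<close>)
    have t: "t j * ((2*k-J)*(\<gamma>+k+1)) = f j * (2*k*(\<gamma>+k+1+J))"
      using hyp_term_shift_u_v[of "-2*k+1" j "\<gamma>+k+1" n "-N" "\<delta>-k"] poch g0 gj d k
      by (simp add: t_def f_def J_def algebra_simps)
    have Qt: "Q * t j * (2*k-J) = f j * k * (\<gamma>+k+1+J) * ((N-2*k)*(\<delta>+k)*(\<sigma>+3*k+3))"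
    proof -
      have "Q * t j * (2*k-J) = (N-2*k)*(\<delta>+k)/2*(\<sigma>+3*k+3) * (t j * ((2*k-J)*(\<gamma>+k+1)))" by (simp add: Q_def)
      also have "\<dots> = f j * k * (\<gamma>+k+1+J) * ((N-2*k)*(\<delta>+k)*(\<sigma>+3*k+3))"
        unfolding t by simp
      finally show ?thesis .
    qed
    have t': "(2*k+1) * t' (Suc j) * ((\<gamma>+k+2+J)*(J+1)) = f j * ((k+1)*(\<delta>-k-1)*(J-N))"
      using hyp_term_Suc_dec_p_y_u[of "-2*k-1" "\<gamma>+k+2" j n "-N" "\<delta>-k-1"] gj k
      by (simp add: t'_def f_def J_def k_def algebra_simps)
    have f': "f (Suc j) * ((J-2*k)*(\<gamma>+k+2+J)*(J+1)) = f j * ((J-k)*(J-N)*(J+\<delta>-k))"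
      using hyp_term_Suc[of "-2*k" j "\<gamma>+k+2" n "-N" "\<delta>-k"] d gj
      by (simp add: f_def J_def k_def algebra_simps)
    let ?D = "(J-2*k)*(\<gamma>+k+2+J)*(J+1)"
    have cert: "P * ?D + k*(\<gamma>+k+1+J)*((N-2*k)*(\<delta>+k)*(\<sigma>+3*k+3))*((\<gamma>+k+2+J)*(J+1))
        - M' * ((k+1)*(\<delta>-k-1)*(J-N)) * (J-2*k) =
      y (J+1) * ((J-k)*(J-N)*(J+\<delta>-k)) - y J * ?D"
      unfolding P_def M'_def y_def \<delta>_def by (rule hypF_certificate)
    have "(P * f j - Q * t j - M * t' (Suc j)) * ?D =
       f j * (P * ?D) + (Q * t j * (2*k-J)) * ((\<gamma>+k+2+J)*(J+1))
       - M' * ((2*k+1) * t' (Suc j) * ((\<gamma>+k+2+J)*(J+1))) * (J-2*k)"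
      unfolding M' by (simp add: algebra_simps)
    also have "\<dots> = f j * (P * ?D + k*(\<gamma>+k+1+J)*((N-2*k)*(\<delta>+k)*(\<sigma>+3*k+3))*((\<gamma>+k+2+J)*(J+1))
        - M' * ((k+1)*(\<delta>-k-1)*(J-N)) * (J-2*k))"
      unfolding Qt t' by Groebner_Basis.algebra
    also have "\<dots> = y (J+1) * (f (Suc j) * ?D) - y J * f j * ?D"
      unfolding cert f' by Groebner_Basis.algebra
    also have "\<dots> = (h (Suc j) - h j) * ?D"
      unfolding h_def J_def by (simp add: algebra_simps)
    finally show ?thesis using d gj by simp
  qed
  have "(\<Sum>j\<le>n. P * f j - Q * t j - M * t' (Suc j)) = (\<Sum>j<n+1. h (Suc j) - h j)"
    by (rule sum.cong) (use step in auto)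
  also have "\<dots> = M"
    unfolding sum_lessThan_telescope
    by (simp add: h_def f_def y_def hyp_term_eq_0 M_def) Groebner_Basis.algebra
  finally have "P * (\<Sum>j\<le>n. f j) = Q * (\<Sum>j\<le>n. t j) + M * (1 + (\<Sum>j\<le>n. t' (Suc j)))"
    by (simp only: sum_distrib_left[symmetric] sum_subtractf) (simp add: algebra_simps)
  moreover have "(\<Sum>j\<le>n. f j) = hypF N \<delta> \<gamma> n"
    by (simp add: hypF_def hyp3F2_eq_sum_hyp_term f_def k_def)
  moreover have "(\<Sum>j\<le>n. t j) = hypH N \<delta> \<gamma> n"
    by (simp add: hypH_def hyp3F2_eq_sum_hyp_term t_def k_def)
  moreover have "1 + (\<Sum>j\<le>n. t' (Suc j)) = hypH N \<delta> \<gamma> (n+1)"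
  proof -
    have e: "\<delta> - real (Suc n) = \<delta>-k-1" "-2 * real (Suc n) + 1 = -2*k-1"
        "\<gamma> + real (Suc n) + 1 = \<gamma>+k+2"
      by (simp_all add: k_def)
    show ?thesis
      unfolding Suc_eq_plus1[symmetric] hypH_def hyp3F2_eq_sum_hyp_term sum.atMost_Suc_shift
      unfolding e t'_def
      by simp
  qed
  ultimately show ?thesis unfolding P_def Q_def M_def by metis
qed

section \<open>Bidiagonal coefficients\<close>

lemma pochhammer_2: "pochhammer x 2 = x * (x + 1)" for x :: "'a::comm_semiring_1"
  by (simp add: numeral_2_eq_2 pochhammer_Suc)

lemma cancel_div_eq: "t \<noteq> 0 \<Longrightarrow> cancel_div s t = s / t"
  by (simp add: cancel_div_def)

lemma hyp3F2_eq_hypH: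
  "hyp3F2 (n + 1) (- N) (\<delta> - real n - 1) (- 2 * real n - 1) (\<gamma> + real n + 2) = hypH N \<delta> \<gamma> (n + 1)"
  unfolding hypH_def by (rule arg_cong4[where f = "\<lambda>a b c d. hyp3F2 a (- N) b c d"]) simp_all

lemma hyp3F2_eq_hypF_Suc:
  "hyp3F2 (n + 1) (- N) (\<delta> - real n - 1) (- 2 * real n - 2) (\<gamma> + real n + 3) = hypF N \<delta> \<gamma> (n + 1)"
  unfolding hypF_def by (rule arg_cong4[where f = "\<lambda>a b c d. hyp3F2 a (- N) b c d"]) simp_all

lemmas hyp_folds = hypF_def[symmetric] hypH_def[symmetric] hyp3F2_eq_hypH hyp3F2_eq_hypF_Suc


text \<open>Replaces the quotient of Pochhammer symbols in \<open>hahn_a2\<close> by 1/2. At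
  \<open>n = 0\<close> that quotient is 1, so this index needs separate treatment.\<close>

lemma pochhammer_half:
  assumes "n \<ge> 1"
  shows "pochhammer (real n + 1) n = 2 * pochhammer (real n) n" "pochhammer (real n) n \<noteq> 0"
proof -
  have "real n * pochhammer (real n + 1) n = pochhammer (real n) n * (real n + real n)"
    by (rule pochhammer_shift)
  thus "pochhammer (real n + 1) n = 2 * pochhammer (real n) n"
    using assms by (simp add: field_simps)
  show "pochhammer (real n) n \<noteq> 0"
    using assms by (intro pochhammer_neq_0) simp
qed

text \<open>Both sides contain the same \<open>cancel_div\<close> quotients, so the equality
  persists where a denominator vanishes.\<close>

lemma hahn_C_eq_a1: "hahn_C \<beta> N (k + 1) (k + 1) \<alpha>1 \<alpha>2 = hahn_a1 N \<alpha>1 \<alpha>2 \<beta> k"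
  unfolding hahn_C_def hahn_a1_def by (simp add: algebra_simps)

text \<open>Here \<open>cancel_div\<close> faces ordinary division, and the two agree only for
  nonzero denominators.\<close>

lemma hahn_C_eq_a4:
  assumes "\<alpha>2 + \<beta> + 3 * real k + 2 \<noteq> 0" "\<alpha>1 + \<beta> + 3 * real k + 3 \<noteq> 0"
  shows "hahn_C \<beta> N (k + 1) (k + 2) \<alpha>2 \<alpha>1 = hahn_a4 N \<alpha>1 \<alpha>2 \<beta> k"
proof -
  have "hahn_C \<beta> N (k + 1) (k + 2) \<alpha>2 \<alpha>1 =
    cancel_div (\<alpha>2 + \<beta> + 2 * real k + 2) (\<alpha>2 + \<beta> + 3 * real k + 2) *
    cancel_div (\<alpha>1 + \<beta> + 2 * real k + 2) (\<alpha>1 + \<beta> + 3 * real k + 3) *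
    ((\<alpha>2 + 1 + real k) * (real N - 2 * real k - 1) / (\<alpha>2 + \<beta> + 3 * real k + 2 + 1))"
    unfolding hahn_C_def by (simp add: algebra_simps)
  thus ?thesis
    using assms by (simp add: cancel_div_eq hahn_a4_def pochhammer_2 mult_ac)
qed

section \<open>Products and sums of the Hahn functions in terms of bidiagonal coefficients\<close>

context
  fixes N :: nat and \<alpha>1 \<alpha>2 \<beta> \<sigma> \<gamma> \<delta> :: real and F H :: "nat \<Rightarrow> real"
  defines "\<sigma> \<equiv> \<alpha>1 + \<beta>" and "\<gamma> \<equiv> \<alpha>2 + \<beta>" and "\<delta> \<equiv> \<alpha>2 - \<alpha>1"
    and "F \<equiv> hypF (real N) \<delta> \<gamma>" and "H \<equiv> hypH (real N) \<delta> \<gamma>"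
begin

lemma hahn_a2_eq:
  assumes "n \<ge> 1" "\<gamma> + 3 * real n + 1 \<noteq> 0"
  shows "hahn_a2 N \<alpha>1 \<alpha>2 \<beta> n =
    (\<gamma> + real n + 1) * (real N - 2 * real n) * (\<beta> + 2 * real n + 1) * (\<delta> + real n) /
    (2 * ((\<gamma> + 3 * real n + 1) * (\<sigma> + 3 * real n + 2) * (\<gamma> + 3 * real n + 2))) * (H n / F n)"
  using assms(2) pochhammer_half[OF assms(1)]
  unfolding hahn_a2_def hyp_folds F_def H_def \<sigma>_def \<gamma>_def \<delta>_def by (simp add: cancel_div_eq mult_ac)

lemma hahn_a3_eq:
  "hahn_a3 N \<alpha>1 \<alpha>2 \<beta> n =
    (2 * real n + 1) * (\<beta> + 2 * real n + 1) * (\<sigma> + 2 * real n + 2) * (\<gamma> + 2 * real n + 2) /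
    ((\<sigma> + 3 * real n + 2) * (\<sigma> + 3 * real n + 3) * (\<gamma> + 3 * real n + 2)) * (H (n + 1) / F n)"
  unfolding hahn_a3_def hyp_folds F_def H_def \<sigma>_def \<gamma>_def \<delta>_def pochhammer_2 by simp

lemma hahn_a5_eq:
  "hahn_a5 N \<alpha>1 \<alpha>2 \<beta> n =
    (real n + 1) * (real N - 2 * real n - 1) * (\<beta> + 2 * real n + 2) * (real n + 1 - \<delta>)
      * (\<sigma> + 2 + real n + real N) /
    ((2 * real n + 1) * (\<sigma> + 3 * real n + 3) * (\<sigma> + 3 * real n + 4) * (\<gamma> + 3 * real n + 3))
      * (F n / H (n + 1))"
  unfolding hahn_a5_def hyp_folds F_def H_def \<sigma>_def \<gamma>_def \<delta>_def pochhammer_2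
  by (simp add: algebra_simps)

lemma hahn_a6_eq:
  "hahn_a6 N \<alpha>1 \<alpha>2 \<beta> n =
    2 * (real n + 1) * (\<beta> + 2 * real n + 2) * (\<sigma> + 2 * real n + 3) * (\<gamma> + 2 * real n + 3)
      * (\<gamma> + 2 + real n + real N) /
    ((\<sigma> + 3 * real n + 4) * (\<gamma> + 3 * real n + 3) * (\<gamma> + 3 * real n + 4) * (\<gamma> + real n + 2))
      * (F (n + 1) / H (n + 1))"
  unfolding hahn_a6_def hyp_folds F_def H_def \<sigma>_def \<gamma>_def \<delta>_def pochhammer_2 by simp

text \<open>The hypergeometric quotients of the two coefficients are reciprocal,
  \<open>2n + 1\<close> cancels, and the remaining linear factors agree on both sides.\<close>

lemma hahn_A_B_eq_a5_a3:
  assumes "F n \<noteq> 0" "H (n + 1) \<noteq> 0"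
  shows "hahn_A \<beta> N (n + 1) (n + 1) \<alpha>1 \<alpha>2 * hahn_B \<beta> N (n + 1) (n + 1) \<alpha>1 \<alpha>2 =
    hahn_a5 N \<alpha>1 \<alpha>2 \<beta> n * hahn_a3 N \<alpha>1 \<alpha>2 \<beta> n"
proof -
  define k where "k = real n"
  have A: "hahn_A \<beta> N (n + 1) (n + 1) \<alpha>1 \<alpha>2 =
      (k + 1) * (\<gamma> + 2*k + 2) * (\<beta> + 2*k + 2) * (\<sigma> + 2 + k + real N) /
      ((\<gamma> + 3*k + 3) * (\<sigma> + 3*k + 3) * (\<sigma> + 3*k + 4))"
    unfolding hahn_A_def k_def \<sigma>_def \<gamma>_def by (simp add: algebra_simps)
  have B: "hahn_B \<beta> N (n + 1) (n + 1) \<alpha>1 \<alpha>2 =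
      (k + 1 - \<delta>) * (\<sigma> + 2*k + 2) * (\<beta> + 2*k + 1) * (real N - 2*k - 1) /
      ((\<gamma> + 3*k + 2) * (\<sigma> + 3*k + 3) * (\<sigma> + 3*k + 2))"
    unfolding hahn_B_def k_def \<sigma>_def \<gamma>_def \<delta>_def by (simp add: algebra_simps)
  have "2 * k + 1 \<noteq> 0" by (simp add: k_def)
  thus ?thesis
    unfolding A B hahn_a3_eq hahn_a5_eq k_def[symmetric] using assms by (simp add: divide_simps mult_ac)
qed

text \<open>Again reciprocal quotients, but across two blocks of six: \<open>hahn_a2\<close> is
  taken at \<open>n + 1\<close>. The 2 from \<open>pochhammer_half\<close> and
  \<open>\<gamma> + n + 2\<close> cancel as well.\<close>

lemma hahn_A_B_eq_a2_a6:
  assumes "F (n + 1) \<noteq> 0" "H (n + 1) \<noteq> 0" "\<gamma> + real n + 2 \<noteq> 0" "\<gamma> + 3 * real n + 4 \<noteq> 0"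
  shows "hahn_A \<beta> N (n + 1) (n + 2) \<alpha>2 \<alpha>1 * hahn_B \<beta> N (n + 1) (n + 2) \<alpha>2 \<alpha>1 =
    hahn_a2 N \<alpha>1 \<alpha>2 \<beta> (n + 1) * hahn_a6 N \<alpha>1 \<alpha>2 \<beta> n"
proof -
  define k where "k = real n"
  have A: "hahn_A \<beta> N (n + 1) (n + 2) \<alpha>2 \<alpha>1 =
      (k + 1) * (\<sigma> + 2*k + 3) * (\<beta> + 2*k + 3) * (\<gamma> + 2 + k + real N) /
      ((\<sigma> + 3*k + 5) * (\<gamma> + 3*k + 4) * (\<gamma> + 3*k + 5))"
    unfolding hahn_A_def k_def \<sigma>_def \<gamma>_def by (simp add: algebra_simps)
  have B: "hahn_B \<beta> N (n + 1) (n + 2) \<alpha>2 \<alpha>1 =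
      (k + 1 + \<delta>) * (\<gamma> + 2*k + 3) * (\<beta> + 2*k + 2) * (real N - 2*k - 2) /
      ((\<sigma> + 3*k + 4) * (\<gamma> + 3*k + 4) * (\<gamma> + 3*k + 3))"
    unfolding hahn_B_def k_def \<sigma>_def \<gamma>_def \<delta>_def by (simp add: algebra_simps)
  have a2: "hahn_a2 N \<alpha>1 \<alpha>2 \<beta> (n + 1) =
      (\<gamma> + k + 2) * (real N - 2*k - 2) * (\<beta> + 2*k + 3) * (k + 1 + \<delta>) /
      (2 * ((\<gamma> + 3*k + 4) * (\<sigma> + 3*k + 5) * (\<gamma> + 3*k + 5))) * (H (n + 1) / F (n + 1))"
  proof -
    have shifts: "\<gamma> + real (n+1) + 1 = \<gamma> + k + 2" "real N - 2 * real (n+1) = real N - 2*k - 2"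
      "\<beta> + 2 * real (n+1) + 1 = \<beta> + 2*k + 3" "\<delta> + real (n+1) = k + 1 + \<delta>"
      "\<gamma> + 3 * real (n+1) + 1 = \<gamma> + 3*k + 4" "\<sigma> + 3 * real (n+1) + 2 = \<sigma> + 3*k + 5"
      "\<gamma> + 3 * real (n+1) + 2 = \<gamma> + 3*k + 5"
      by (simp_all add: k_def)
    show ?thesis
      using hahn_a2_eq[of "n+1"] assms(4) unfolding shifts k_def[symmetric] by simp
  qed
  show ?thesis
    unfolding A B a2 hahn_a6_eq k_def[symmetric]
    using assms unfolding k_def[symmetric]
    by (simp add: divide_simps mult_ac) (simp add: algebra_simps)
qed

lemma hahn_A_D_eq_a5_a6:
  assumes ne: "\<And>i. i \<in> {n + 2..3 * n + 4} \<Longrightarrow> \<gamma> + real i \<noteq> 0"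
    and "\<sigma> + 3 * real n + 3 \<noteq> 0" "\<sigma> + 3 * real n + 4 \<noteq> 0" and H: "H (n + 1) \<noteq> 0"
  shows "hahn_A \<beta> N (n + 1) (n + 1) \<alpha>1 \<alpha>2 + hahn_A \<beta> N (n + 1) (n + 1) \<alpha>2 (\<alpha>1 + 1)
      + hahn_D \<beta> N (n + 1) (n + 1) \<alpha>1 \<alpha>2 =
    hahn_a5 N \<alpha>1 \<alpha>2 \<beta> n + hahn_a6 N \<alpha>1 \<alpha>2 \<beta> n"
proof -
  define k where "k = real n + 1"
  define d1 d2 d3 d4 w q where "d1 = \<gamma> + 3*k" and "d2 = \<gamma> + 3*k + 1"
    and "d3 = \<sigma> + 3*k" and "d4 = \<sigma> + 3*k + 1" and "w = \<gamma> + k + 1" and "q = 2*k - 1"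
  note d_defs = d1_def d2_def d3_def d4_def w_def q_def
  have d: "d1 \<noteq> 0" "d2 \<noteq> 0" "d3 \<noteq> 0" "d4 \<noteq> 0" "w \<noteq> 0" "q \<noteq> 0"
    using ne[of "3*n+3"] ne[of "3*n+4"] ne[of "n+2"] assms(2,3)
    by (auto simp: d_defs k_def algebra_simps)
  have A: "hahn_A \<beta> N (n + 1) (n + 1) \<alpha>1 \<alpha>2 =
      (2*k+\<beta>)*k * ((2*k+\<gamma>)*(real N+k+\<sigma>+1)) / (d1*d3*d4)"
    unfolding hahn_A_def d_defs k_def \<sigma>_def \<gamma>_def by (simp add: algebra_simps)
  have A': "hahn_A \<beta> N (n + 1) (n + 1) \<alpha>2 (\<alpha>1 + 1) =
      (2*k+\<beta>)*k * ((2*k+\<sigma>+1)*(real N+k+\<gamma>+1)) / (d4*d1*d2)"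
    unfolding hahn_A_def d_defs k_def \<sigma>_def \<gamma>_def by (simp add: algebra_simps)
  have D: "hahn_D \<beta> N (n + 1) (n + 1) \<alpha>1 \<alpha>2 = (2*k+\<beta>)*k * k / (d4*d1)"
    unfolding hahn_D_def d_defs k_def \<sigma>_def \<gamma>_def by (simp add: algebra_simps)
  have a5: "hahn_a5 N \<alpha>1 \<alpha>2 \<beta> n =
      (2*k+\<beta>)*k * ((real N-2*k+1)*(k-\<delta>)*(\<sigma>+1+k+real N)) / (q*d3*d4*d1) * (F n / H (n + 1))"
    unfolding hahn_a5_eq d_defs k_def by (simp add: algebra_simps)
  have a6: "hahn_a6 N \<alpha>1 \<alpha>2 \<beta> n =
      (2*k+\<beta>)*k * (2*(\<sigma>+2*k+1)*(\<gamma>+2*k+1)*(\<gamma>+1+k+real N)) / (d4*d1*d2*w) * (F (n + 1) / H (n + 1))"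
    unfolding hahn_a6_eq d_defs k_def by (simp add: algebra_simps)
  \<comment> \<open>With opaque numerators, clearing \<open>d1*d2*d3*d4*h\<close> leaves exactly the
    shape of \<open>hypH_rel\<close>. The common factor \<open>e\<close> is only multiplied in, so
    it may vanish.\<close>
  have frac: "e*p1/(d1*d3*d4) + e*p2/(d4*d1*d2) + e*p3/(d4*d1) =
      e*r1/(q*d3*d4*d1)*(f/h) + e*r2/(d4*d1*d2*w)*(f'/h)"
    if "(p1*d2 + p2*d3 + p3*d3*d2)*h = r1*d2/q*f + r2*d3/w*f'" "h \<noteq> 0" for e p1 p2 p3 r1 r2 f f' h
  proof -
    have "e*p1/(d1*d3*d4) + e*p2/(d4*d1*d2) + e*p3/(d4*d1) =
        e * ((p1*d2 + p2*d3 + p3*d3*d2)*h) / (d1*d2*d3*d4*h)"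
      using d that(2) by (simp add: divide_simps) Groebner_Basis.algebra
    also have "\<dots> = e*r1/(q*d3*d4*d1)*(f/h) + e*r2/(d4*d1*d2*w)*(f'/h)"
      unfolding that(1) using d that(2) by (simp add: divide_simps) Groebner_Basis.algebra
    finally show ?thesis .
  qed
  have \<delta>: "\<gamma> - \<sigma> = \<delta>" by (simp add: \<sigma>_def \<gamma>_def \<delta>_def)
  show ?thesis
    unfolding A A' D a5 a6
  proof (rule frac)
    have "\<gamma> + real i \<noteq> 0" if "i \<in> {n + 2..2 * n + 3}" for i
      using ne[of i] that by auto
    from hypH_rel[of n \<gamma> "real N" \<sigma>, OF this, folded k_def F_def H_def, unfolded \<delta>]
    show "((2*k+\<gamma>)*(real N+k+\<sigma>+1)*d2 + (2*k+\<sigma>+1)*(real N+k+\<gamma>+1)*d3 + k*d3*d2) * H (n+1) =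
      (real N-2*k+1)*(k-\<delta>)*(\<sigma>+1+k+real N)*d2/q * F n
      + 2*(\<sigma>+2*k+1)*(\<gamma>+2*k+1)*(\<gamma>+1+k+real N)*d3/w * F (n+1)"
      unfolding d_defs F_def H_def by (simp add: add_ac mult_ac)
  qed (rule H)
qed

lemma hahn_A_D_eq_a2_a3:
  assumes ne: "\<And>i. i \<in> {n + 1..3 * n + 2} \<Longrightarrow> 2 \<le> i \<Longrightarrow> \<gamma> + real i \<noteq> 0"
    and "\<sigma> + 3 * real n + 2 \<noteq> 0" "\<sigma> + 3 * real n + 3 \<noteq> 0" and F: "F n \<noteq> 0"
  shows "hahn_A \<beta> N n (n + 1) \<alpha>2 \<alpha>1 + hahn_A \<beta> N (n + 1) n \<alpha>1 (\<alpha>2 + 1)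
      + hahn_D \<beta> N n (n + 1) \<alpha>2 \<alpha>1 =
    hahn_a2 N \<alpha>1 \<alpha>2 \<beta> n + hahn_a3 N \<alpha>1 \<alpha>2 \<beta> n"
\<comment> \<open>Index 0 is evaluated directly: \<open>hypF_rel\<close> starts at 1, and \<gamma> +
  1 may be 0 here, where \<open>cancel_div\<close> in \<open>hahn_a2\<close> gives 1.\<close>
proof (cases "n = 0")
  case True
  define M where "M = real N"
  have ne: "\<gamma> + 2 \<noteq> 0" "\<sigma> + 2 \<noteq> 0" "\<sigma> + 3 \<noteq> 0" using assms(2,3) ne[of 2] True by auto
  have A: "hahn_A \<beta> N 0 1 \<alpha>2 \<alpha>1 = 0" "hahn_D \<beta> N 0 1 \<alpha>2 \<alpha>1 = 0"
    "hahn_A \<beta> N 1 0 \<alpha>1 (\<alpha>2 + 1) = (\<gamma>+2)*(\<beta>+1)*(M+\<sigma>+2) / ((\<gamma>+2)*(\<sigma>+2)*(\<sigma>+3))"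
    by (simp_all add: hahn_A_def hahn_D_def \<sigma>_def \<gamma>_def M_def add_ac)
  have a2: "hahn_a2 N \<alpha>1 \<alpha>2 \<beta> 0 = M*(\<beta>+1)*\<delta> / ((\<sigma>+2)*(\<gamma>+2))"
    by (simp add: hahn_a2_def cancel_div_def hyp3F2_def \<sigma>_def \<gamma>_def \<delta>_def M_def)
  have H: "H 1 = ((\<gamma>+2) - M*(\<delta>-1)) / (\<gamma>+2)" and F: "F 0 = 1"
    using ne by (simp_all add: F_def H_def hypH_def hypF_def hyp3F2_def M_def field_simps)
  have a3: "hahn_a3 N \<alpha>1 \<alpha>2 \<beta> 0 = (\<beta>+1)*(\<sigma>+2)*(\<gamma>+2) / ((\<sigma>+2)*(\<sigma>+3)*(\<gamma>+2)) * H 1"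
    by (simp add: hahn_a3_eq F)
  have \<sigma>: "\<sigma> = \<gamma> - \<delta>" by (simp add: \<sigma>_def \<gamma>_def \<delta>_def)
  have "hahn_A \<beta> N 0 1 \<alpha>2 \<alpha>1 + hahn_A \<beta> N 1 0 \<alpha>1 (\<alpha>2 + 1) + hahn_D \<beta> N 0 1 \<alpha>2 \<alpha>1 =
      hahn_a2 N \<alpha>1 \<alpha>2 \<beta> 0 + hahn_a3 N \<alpha>1 \<alpha>2 \<beta> 0"
    unfolding A a2 a3 H using ne by (simp add: divide_simps) (simp add: \<sigma> algebra_simps)
  thus ?thesis using True by simp
next
  case False
  hence n: "n \<ge> 1" by simp
  define k where "k = real n"
  define d1 d2 d3 d4 where "d1 = \<gamma> + 3*k + 1" and "d2 = \<gamma> + 3*k + 2"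
    and "d3 = \<sigma> + 3*k + 2" and "d4 = \<sigma> + 3*k + 3"
  note d_defs = d1_def d2_def d3_def d4_def
  have d: "d1 \<noteq> 0" "d2 \<noteq> 0" "d3 \<noteq> 0" "d4 \<noteq> 0"
    using ne[of "3*n+1"] ne[of "3*n+2"] assms(2,3) n
    by (auto simp: d_defs k_def algebra_simps)
  have A: "hahn_A \<beta> N n (n + 1) \<alpha>2 \<alpha>1 =
      (2*k+\<beta>+1) * (k*(2*k+1+\<sigma>)*(real N+k+\<gamma>+1)) / (d1*d2*d3)"
    unfolding hahn_A_def d_defs k_def \<sigma>_def \<gamma>_def by (simp add: algebra_simps)
  have A': "hahn_A \<beta> N (n + 1) n \<alpha>1 (\<alpha>2 + 1) =
      (2*k+\<beta>+1) * ((k+1)*(2*k+2+\<gamma>)*(real N+k+\<sigma>+2)) / (d2*d3*d4)"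
    unfolding hahn_A_def d_defs k_def \<sigma>_def \<gamma>_def by (simp add: algebra_simps)
  have D: "hahn_D \<beta> N n (n + 1) \<alpha>2 \<alpha>1 = (2*k+\<beta>+1) * (k*(k+1)) / (d2*d3)"
    unfolding hahn_D_def d_defs k_def \<sigma>_def \<gamma>_def by (simp add: algebra_simps)
  have a2: "hahn_a2 N \<alpha>1 \<alpha>2 \<beta> n =
      (2*k+\<beta>+1) * ((\<gamma>+k+1)*(real N-2*k)*(\<delta>+k)/2) / (d1*d3*d2) * (H n / F n)"
    using hahn_a2_eq[OF n] d(1) unfolding d_defs k_def by (simp add: add_ac mult_ac)
  have a3: "hahn_a3 N \<alpha>1 \<alpha>2 \<beta> n =
      (2*k+\<beta>+1) * ((2*k+1)*(\<sigma>+2*k+2)*(\<gamma>+2*k+2)) / (d3*d4*d2) * (H (n + 1) / F n)"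
    unfolding hahn_a3_eq d_defs k_def by (simp add: add_ac mult_ac)
  \<comment> \<open>The same reduction as for the other sum, now to the shape of
    \<open>hypF_rel\<close>.\<close>
  have frac: "e*p1/(d1*d2*d3) + e*p2/(d2*d3*d4) + e*p3/(d2*d3) =
      e*r1/(d1*d3*d2)*(f/h) + e*r2/(d3*d4*d2)*(f'/h)"
    if "(p1*d4 + p2*d1 + p3*d4*d1)*h = r1*d4*f + r2*d1*f'" "h \<noteq> 0" for e p1 p2 p3 r1 r2 f f' h
  proof -
    have "e*p1/(d1*d2*d3) + e*p2/(d2*d3*d4) + e*p3/(d2*d3) =
        e * ((p1*d4 + p2*d1 + p3*d4*d1)*h) / (d1*d2*d3*d4*h)"
      using d that(2) by (simp add: divide_simps) Groebner_Basis.algebra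
    also have "\<dots> = e*r1/(d1*d3*d2)*(f/h) + e*r2/(d3*d4*d2)*(f'/h)"
      unfolding that(1) using d that(2) by (simp add: divide_simps) Groebner_Basis.algebra
    finally show ?thesis .
  qed
  have \<delta>: "\<gamma> - \<sigma> = \<delta>" by (simp add: \<sigma>_def \<gamma>_def \<delta>_def)
  show ?thesis
    unfolding A A' D a2 a3
  proof (rule frac)
    have "\<gamma> + real i \<noteq> 0" if "i \<in> {n + 1..2 * n + 2}" for i
      using ne[of i] that n by auto
    from hypF_rel[of n \<gamma> \<sigma> "real N", OF n this, folded k_def F_def H_def, unfolded \<delta>]
    show "(k*(2*k+1+\<sigma>)*(real N+k+\<gamma>+1)*d4 + (k+1)*(2*k+2+\<gamma>)*(real N+k+\<sigma>+2)*d1 + k*(k+1)*d4*d1) * F n =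
      (\<gamma>+k+1)*(real N-2*k)*(\<delta>+k)/2*d4 * H n
      + (2*k+1)*(\<sigma>+2*k+2)*(\<gamma>+2*k+2)*d1 * H (n+1)"
      unfolding d_defs F_def H_def by (simp add: add_ac mult_ac)
  qed (rule F)
qed

end

section \<open>Product of bidiagonal matrices\<close>

text \<open>Left multiplication by a unit lower bidiagonal matrix is a row operation: each row
  receives a multiple of the row above.\<close>

lemma lower_bidiagonal_mult:
  fixes B :: "real mat"
  assumes "B \<in> carrier_mat m p" "i < m" "j < p"
  shows "(mat m m (\<lambda>(i, j). if i = j then 1 else if i = j + 1 then l j else 0) * B) $$ (i, j) =
    B $$ (i, j) + (if i = 0 then 0 else l (i - 1) * B $$ (i - 1, j))"
proof -
  have "(mat m m (\<lambda>(i, j). if i = j then 1 else if i = j + 1 then l j else 0) * B) $$ (i, j) =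
      (\<Sum>k<m. (if i = k then 1 else if i = k + 1 then l k else 0) * B $$ (k, j))"
    using assms by (simp add: scalar_prod_def lessThan_atLeast0)
  \<comment> \<open>Two Kronecker deltas. The inner test on \<open>i = 0\<close> is needed because
    \<open>i - 1\<close> is then 0 again.\<close>
  also have "\<dots> = (\<Sum>k<m. (if k = i then B $$ (i, j) else 0)
      + (if k = i - 1 then if i = 0 then 0 else l (i - 1) * B $$ (i - 1, j) else 0))"
    by (rule sum.cong) auto
  also have "\<dots> = B $$ (i, j) + (if i = 0 then 0 else l (i - 1) * B $$ (i - 1, j))"
    using assms(2) by (simp add: sum.distrib)
  finally show ?thesis .
qed

text \<open>The conditions are the nonconstant bands of the product, read entrywise. The first
  entries are separate because \<open>L1\<close> and \<open>L2\<close> together reach two rows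
  back.\<close>

lemma tetra_mat_factorization:
  assumes b0: "b 0 = a 1"
    and b: "\<And>i. i + 1 < m \<Longrightarrow> b (i + 1) = a (3 * i + 2) + a (3 * i + 3) + a (3 * i + 4)"
    and c1: "1 < m \<Longrightarrow> c 1 = (a 2 + a 3) * a 1"
    and c: "\<And>i. i + 2 < m \<Longrightarrow>
      c (i + 2) = (a (3 * i + 5) + a (3 * i + 6)) * a (3 * i + 4) + a (3 * i + 5) * a (3 * i + 3)"
    and d: "\<And>i. i + 2 < m \<Longrightarrow> d (i + 2) = a (3 * i + 5) * a (3 * i + 3) * a (3 * i + 1)"
  shows "tetra_mat b c d m = L1_mat a m * L2_mat a m * U_mat a m"
proof (rule eq_matI)
  fix i j assume "i < dim_row (L1_mat a m * L2_mat a m * U_mat a m)"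
    "j < dim_col (L1_mat a m * L2_mat a m * U_mat a m)"
  hence ij: "i < m" "j < m" by (simp_all add: L1_mat_def U_mat_def)
  have carrier: "L1_mat a m \<in> carrier_mat m m" "L2_mat a m \<in> carrier_mat m m" "U_mat a m \<in> carrier_mat m m"
    by (simp_all add: L1_mat_def L2_mat_def U_mat_def)
  have L2: "(L2_mat a m * U_mat a m) $$ (i, j) = U_mat a m $$ (i, j)
      + (if i = 0 then 0 else a (3 * (i - 1) + 3) * U_mat a m $$ (i - 1, j))" if "i < m" for i
    unfolding L2_mat_def using carrier ij that by (intro lower_bidiagonal_mult) auto
  have L1: "(L1_mat a m * (L2_mat a m * U_mat a m)) $$ (i, j) = (L2_mat a m * U_mat a m) $$ (i, j)
      + (if i = 0 then 0 else a (3 * (i - 1) + 2) * (L2_mat a m * U_mat a m) $$ (i - 1, j))" if "i < m" for i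
    unfolding L1_mat_def using carrier ij that by (intro lower_bidiagonal_mult) auto
  have U: "U_mat a m $$ (i, j) = (if i = j then a (3 * i + 1) else if j = i + 1 then 1 else 0)"
    if "i < m" for i
    using that ij by (simp add: U_mat_def)
  define u where "u k = (if k = j then a (3 * k + 1) else if j = k + 1 then 1 else 0)" for k
  \<comment> \<open>Reassociated so that both lower factors act as row operations on
    \<open>U\<close>.\<close>
  have "(L1_mat a m * L2_mat a m * U_mat a m) $$ (i, j) = (L1_mat a m * (L2_mat a m * U_mat a m)) $$ (i, j)"
    using carrier by (simp add: assoc_mult_mat)
  also have "\<dots> = u i + (if i = 0 then 0 else a (3 * (i - 1) + 3) * u (i - 1)
      + a (3 * (i - 1) + 2) * (u (i - 1) + (if i = 1 then 0 else a (3 * (i - 2) + 3) * u (i - 2))))"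
    using ij by (simp add: L1 L2 U u_def diff_diff_eq numeral_2_eq_2)
  also have "\<dots> = tetra_mat b c d m $$ (i, j)"
  proof -
    \<comment> \<open>From row 2 on, both \<open>i - 1\<close> and \<open>i - 2\<close> are genuine
      predecessors.\<close>
    consider "i = 0" | "i = 1" | h where "i = h + 2"
      by (metis One_nat_def add_2_eq_Suc' not0_implies_Suc)
    thus ?thesis
    proof cases
      case 1
      thus ?thesis using ij b0 by (simp add: u_def tetra_mat_def)
    next
      case 2
      consider "j = 0" | "j = 1" | "j = 2" | "j > 2" by linarith
      thus ?thesis using ij 2 b[of 0] c1
        by cases (simp_all add: u_def tetra_mat_def algebra_simps flip: numeral_2_eq_2)
    next
      case 3
      consider "j > h + 3" | "j = h + 3" | "j = h + 2" | "j = h + 1" | "j = h" | "j < h"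
        by linarith
      thus ?thesis using ij 3 b[of "h + 1"] c[of h] d[of h]
        by cases (simp_all add: u_def tetra_mat_def algebra_simps flip: numeral_2_eq_2)
    qed
  qed
  finally show "tetra_mat b c d m $$ (i, j) = (L1_mat a m * L2_mat a m * U_mat a m) $$ (i, j)" ..
qed (simp_all add: tetra_mat_def L1_mat_def U_mat_def)

section \<open>Factorization and positivity\<close>

lemma hahn_a_simps:
  "hahn_a N \<alpha>1 \<alpha>2 \<beta> (6 * n + 1) = hahn_a1 N \<alpha>1 \<alpha>2 \<beta> n"
  "hahn_a N \<alpha>1 \<alpha>2 \<beta> (6 * n + 2) = hahn_a2 N \<alpha>1 \<alpha>2 \<beta> n"
  "hahn_a N \<alpha>1 \<alpha>2 \<beta> (6 * n + 3) = hahn_a3 N \<alpha>1 \<alpha>2 \<beta> n"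
  "hahn_a N \<alpha>1 \<alpha>2 \<beta> (6 * n + 4) = hahn_a4 N \<alpha>1 \<alpha>2 \<beta> n"
  "hahn_a N \<alpha>1 \<alpha>2 \<beta> (6 * n + 5) = hahn_a5 N \<alpha>1 \<alpha>2 \<beta> n"
  "hahn_a N \<alpha>1 \<alpha>2 \<beta> (6 * n + 6) = hahn_a6 N \<alpha>1 \<alpha>2 \<beta> n"
proof -
  have "hahn_a N \<alpha>1 \<alpha>2 \<beta> (6 * n + r + 1) =
      (if r = 0 then hahn_a1 N \<alpha>1 \<alpha>2 \<beta> n else if r = 1 then hahn_a2 N \<alpha>1 \<alpha>2 \<beta> n
       else if r = 2 then hahn_a3 N \<alpha>1 \<alpha>2 \<beta> n else if r = 3 then hahn_a4 N \<alpha>1 \<alpha>2 \<beta> n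
       else if r = 4 then hahn_a5 N \<alpha>1 \<alpha>2 \<beta> n else hahn_a6 N \<alpha>1 \<alpha>2 \<beta> n)" if "r < 6" for r
    using that by (simp add: hahn_a_def)
  from this[of 0] this[of 1] this[of 2] this[of 3] this[of 4] this[of 5]
  show "hahn_a N \<alpha>1 \<alpha>2 \<beta> (6 * n + 1) = hahn_a1 N \<alpha>1 \<alpha>2 \<beta> n"
    "hahn_a N \<alpha>1 \<alpha>2 \<beta> (6 * n + 2) = hahn_a2 N \<alpha>1 \<alpha>2 \<beta> n"
    "hahn_a N \<alpha>1 \<alpha>2 \<beta> (6 * n + 3) = hahn_a3 N \<alpha>1 \<alpha>2 \<beta> n"
    "hahn_a N \<alpha>1 \<alpha>2 \<beta> (6 * n + 4) = hahn_a4 N \<alpha>1 \<alpha>2 \<beta> n"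
    "hahn_a N \<alpha>1 \<alpha>2 \<beta> (6 * n + 5) = hahn_a5 N \<alpha>1 \<alpha>2 \<beta> n"
    "hahn_a N \<alpha>1 \<alpha>2 \<beta> (6 * n + 6) = hahn_a6 N \<alpha>1 \<alpha>2 \<beta> n"
    by (simp_all add: eval_nat_numeral)
qed

text \<open>The two \<open>hahn_A\<close> terms and \<open>hahn_D\<close> are bracketed together so
  that the sum identities rewrite them as one block.\<close>

lemma hahn_bcd_simps:
  "hahn_b N \<alpha>1 \<alpha>2 \<beta> (2 * k) =
    (hahn_A \<beta> N k k \<alpha>1 \<alpha>2 + hahn_A \<beta> N k k \<alpha>2 (\<alpha>1 + 1) + hahn_D \<beta> N k k \<alpha>1 \<alpha>2)
    + hahn_C \<beta> N (k + 1) (k + 1) \<alpha>1 \<alpha>2"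
  "hahn_b N \<alpha>1 \<alpha>2 \<beta> (2 * k + 1) =
    (hahn_A \<beta> N k (k + 1) \<alpha>2 \<alpha>1 + hahn_A \<beta> N (k + 1) k \<alpha>1 (\<alpha>2 + 1) + hahn_D \<beta> N k (k + 1) \<alpha>2 \<alpha>1)
    + hahn_C \<beta> N (k + 1) (k + 2) \<alpha>2 \<alpha>1"
  "hahn_c N \<alpha>1 \<alpha>2 \<beta> (2 * k) =
    (hahn_A \<beta> N k k \<alpha>1 \<alpha>2 + hahn_A \<beta> N k k \<alpha>2 (\<alpha>1 + 1) + hahn_D \<beta> N k k \<alpha>1 \<alpha>2)
      * hahn_C \<beta> N k (k + 1) \<alpha>2 \<alpha>1
    + hahn_A \<beta> N k k \<alpha>1 \<alpha>2 * hahn_B \<beta> N k k \<alpha>1 \<alpha>2"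
  "hahn_c N \<alpha>1 \<alpha>2 \<beta> (2 * k + 1) =
    (hahn_A \<beta> N k (k + 1) \<alpha>2 \<alpha>1 + hahn_A \<beta> N (k + 1) k \<alpha>1 (\<alpha>2 + 1) + hahn_D \<beta> N k (k + 1) \<alpha>2 \<alpha>1)
      * hahn_C \<beta> N (k + 1) (k + 1) \<alpha>1 \<alpha>2
    + hahn_A \<beta> N k (k + 1) \<alpha>2 \<alpha>1 * hahn_B \<beta> N k (k + 1) \<alpha>2 \<alpha>1"
  "hahn_d N \<alpha>1 \<alpha>2 \<beta> (2 * k) =
    hahn_A \<beta> N k k \<alpha>1 \<alpha>2 * hahn_B \<beta> N k k \<alpha>1 \<alpha>2 * hahn_C \<beta> N k k \<alpha>1 \<alpha>2"
  "hahn_d N \<alpha>1 \<alpha>2 \<beta> (2 * k + 1) =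
    hahn_A \<beta> N k (k + 1) \<alpha>2 \<alpha>1 * hahn_B \<beta> N k (k + 1) \<alpha>2 \<alpha>1 * hahn_C \<beta> N k (k + 1) \<alpha>2 \<alpha>1"
  by (simp_all add: hahn_b_def hahn_c_def hahn_d_def Let_def)

lemma hahn_T_factorization:
  assumes adm: "hahn_admissible N \<alpha>1 \<alpha>2 \<beta>" and m: "m \<le> N + 1"
  shows "hahn_T N \<alpha>1 \<alpha>2 \<beta> m = L1_mat (hahn_a N \<alpha>1 \<alpha>2 \<beta>) m * L2_mat (hahn_a N \<alpha>1 \<alpha>2 \<beta>) m
    * U_mat (hahn_a N \<alpha>1 \<alpha>2 \<beta>) m"
proof -
  have \<sigma>: "\<alpha>1 + \<beta> + real i \<noteq> 0" if "2 \<le> i" "2 * i \<le> 3 * N + 3" for i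
    using adm that unfolding hahn_admissible_def by auto
  have \<gamma>: "\<alpha>2 + \<beta> + real i \<noteq> 0" if "2 \<le> i" "2 * i \<le> 3 * N + 2" for i
    using adm that unfolding hahn_admissible_def by auto
  have F: "hypF (real N) (\<alpha>2 - \<alpha>1) (\<alpha>2 + \<beta>) n \<noteq> 0" if "2 * n + 1 \<le> N" for n
    using adm that unfolding hahn_admissible_def hyp_folds by auto
  have H: "hypH (real N) (\<alpha>2 - \<alpha>1) (\<alpha>2 + \<beta>) (n + 1) \<noteq> 0" if "2 * n + 2 \<le> N" for n
    using adm that unfolding hahn_admissible_def hyp_folds by auto
  note A_B_odd = hahn_A_B_eq_a5_a3[OF F H]
  have A_B_even: "hahn_A \<beta> N (k + 1) (k + 2) \<alpha>2 \<alpha>1 * hahn_B \<beta> N (k + 1) (k + 2) \<alpha>2 \<alpha>1 =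
      hahn_a2 N \<alpha>1 \<alpha>2 \<beta> (k + 1) * hahn_a6 N \<alpha>1 \<alpha>2 \<beta> k" if "2 * k + 3 \<le> N" for k
    using \<gamma>[of "k + 2"] \<gamma>[of "3 * k + 4"] that
    by (intro hahn_A_B_eq_a2_a6 F H) (auto simp: add_ac)
  have sum_odd: "hahn_A \<beta> N k (k + 1) \<alpha>2 \<alpha>1 + hahn_A \<beta> N (k + 1) k \<alpha>1 (\<alpha>2 + 1)
      + hahn_D \<beta> N k (k + 1) \<alpha>2 \<alpha>1 = hahn_a2 N \<alpha>1 \<alpha>2 \<beta> k + hahn_a3 N \<alpha>1 \<alpha>2 \<beta> k"
    if "2 * k + 1 \<le> N" for k
    using \<sigma>[of "3 * k + 2"] \<sigma>[of "3 * k + 3"] that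
    by (intro hahn_A_D_eq_a2_a3 F \<gamma>) (auto simp: add_ac)
  have sum_even: "hahn_A \<beta> N (k + 1) (k + 1) \<alpha>1 \<alpha>2 + hahn_A \<beta> N (k + 1) (k + 1) \<alpha>2 (\<alpha>1 + 1)
      + hahn_D \<beta> N (k + 1) (k + 1) \<alpha>1 \<alpha>2 = hahn_a5 N \<alpha>1 \<alpha>2 \<beta> k + hahn_a6 N \<alpha>1 \<alpha>2 \<beta> k"
    if "2 * k + 2 \<le> N" for k
    using \<sigma>[of "3 * k + 3"] \<sigma>[of "3 * k + 4"] that
    by (intro hahn_A_D_eq_a5_a6 H \<gamma>) (auto simp: add_ac)
  have C_odd: "hahn_C \<beta> N (k + 1) (k + 2) \<alpha>2 \<alpha>1 = hahn_a4 N \<alpha>1 \<alpha>2 \<beta> k" if "2 * k + 1 \<le> N" for k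
    using \<gamma>[of "3 * k + 2"] \<sigma>[of "3 * k + 3"] that
    by (intro hahn_C_eq_a4) (auto simp: add_ac)
  \<comment> \<open>Terms with first index 0 drop out, which gives \<open>b 0\<close> and
    \<open>c 1\<close> their shortened form.\<close>
  have zero: "hahn_A \<beta> N 0 n2 x y = 0" "hahn_D \<beta> N 0 n2 x y = 0" for n2 x y
    by (simp_all add: hahn_A_def hahn_D_def)
  note C_even = hahn_C_eq_a1[of \<beta> N _ \<alpha>1 \<alpha>2]
  let ?a = "hahn_a N \<alpha>1 \<alpha>2 \<beta>"
  show ?thesis
  proof (rule tetra_mat_factorization)
    show "hahn_b N \<alpha>1 \<alpha>2 \<beta> 0 = hahn_a N \<alpha>1 \<alpha>2 \<beta> 1"
      using hahn_C_eq_a1[of \<beta> N 0 \<alpha>1 \<alpha>2] hahn_a_simps(1)[of N \<alpha>1 \<alpha>2 \<beta> 0] by (simp add: hahn_b_def zero)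
  next
    assume "1 < m"
    thus "hahn_c N \<alpha>1 \<alpha>2 \<beta> 1 =
        (hahn_a N \<alpha>1 \<alpha>2 \<beta> 2 + hahn_a N \<alpha>1 \<alpha>2 \<beta> 3) * hahn_a N \<alpha>1 \<alpha>2 \<beta> 1"
      using m sum_odd[of 0] hahn_C_eq_a1[of \<beta> N 0 \<alpha>1 \<alpha>2] hahn_a_simps[of N \<alpha>1 \<alpha>2 \<beta> 0]
      by (simp add: hahn_c_def zero flip: numeral_2_eq_2)
  next
    fix i assume i: "i + 1 < m"
    show "hahn_b N \<alpha>1 \<alpha>2 \<beta> (i + 1) = ?a (3 * i + 2) + ?a (3 * i + 3) + ?a (3 * i + 4)"
    proof (cases "even i")
      case True
      then obtain k where k: "i = 2 * k" by (elim evenE)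
      have "2 * k + 1 \<le> N" using i m k by simp
      moreover have "3 * i + 2 = 6 * k + 2" "3 * i + 3 = 6 * k + 3" "3 * i + 4 = 6 * k + 4" "i + 1 = 2 * k + 1"
        using k by simp_all
      ultimately show ?thesis
        by (simp only: hahn_bcd_simps sum_odd C_odd hahn_a_simps)
    next
      case False
      then obtain k where k: "i = 2 * k + 1" by (elim oddE)
      have "2 * k + 2 \<le> N" using i m k by simp
      \<comment> \<open>For odd \<open>i\<close> the last index passes into the next block of
        six.\<close>
      moreover have "3 * i + 2 = 6 * k + 5" "3 * i + 3 = 6 * k + 6" "3 * i + 4 = 6 * (k + 1) + 1" "i + 1 = 2 * (k + 1)"
        using k by simp_all
      ultimately show ?thesis
        by (simp only: hahn_bcd_simps sum_even C_even hahn_a_simps)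
    qed
  next
    fix i assume i: "i + 2 < m"
    show "hahn_c N \<alpha>1 \<alpha>2 \<beta> (i + 2) = (?a (3 * i + 5) + ?a (3 * i + 6)) * ?a (3 * i + 4)
        + ?a (3 * i + 5) * ?a (3 * i + 3)"
      "hahn_d N \<alpha>1 \<alpha>2 \<beta> (i + 2) = ?a (3 * i + 5) * ?a (3 * i + 3) * ?a (3 * i + 1)"
    proof -
      consider k where "i = 2 * k" | k where "i = 2 * k + 1" by (metis evenE oddE)
      hence "hahn_c N \<alpha>1 \<alpha>2 \<beta> (i + 2) = (?a (3 * i + 5) + ?a (3 * i + 6)) * ?a (3 * i + 4)
          + ?a (3 * i + 5) * ?a (3 * i + 3) \<and>
        hahn_d N \<alpha>1 \<alpha>2 \<beta> (i + 2) = ?a (3 * i + 5) * ?a (3 * i + 3) * ?a (3 * i + 1)"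
      proof cases
        case k: (1 k)
        have "2 * k + 2 \<le> N" "2 * k + 1 \<le> N" using i m k by simp_all
        moreover have "3 * i + 1 = 6 * k + 1" "3 * i + 3 = 6 * k + 3" "3 * i + 4 = 6 * k + 4"
          "3 * i + 5 = 6 * k + 5" "3 * i + 6 = 6 * k + 6" "i + 2 = 2 * (k + 1)" "k + 1 + 1 = k + 2"
          using k by simp_all
        ultimately show ?thesis
          by (simp only: hahn_bcd_simps sum_even A_B_odd C_odd C_even hahn_a_simps)
      next
        case k: (2 k)
        have "2 * k + 3 \<le> N" "2 * (k + 1) + 1 \<le> N" "2 * k + 1 \<le> N" using i m k by simp_all
        moreover have "3 * i + 1 = 6 * k + 4" "3 * i + 3 = 6 * k + 6" "3 * i + 4 = 6 * (k + 1) + 1"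
          "3 * i + 5 = 6 * (k + 1) + 2" "3 * i + 6 = 6 * (k + 1) + 3" "i + 2 = 2 * (k + 1) + 1"
          using k by simp_all
        \<comment> \<open>Restated with \<open>k + 1 + 1\<close>, the form that
          \<open>hahn_bcd_simps\<close> produces at \<open>k + 1\<close>.\<close>
        moreover have "hahn_A \<beta> N (k + 1) (k + 1 + 1) \<alpha>2 \<alpha>1 * hahn_B \<beta> N (k + 1) (k + 1 + 1) \<alpha>2 \<alpha>1 =
            hahn_a2 N \<alpha>1 \<alpha>2 \<beta> (k + 1) * hahn_a6 N \<alpha>1 \<alpha>2 \<beta> k"
          "hahn_C \<beta> N (k + 1) (k + 1 + 1) \<alpha>2 \<alpha>1 = hahn_a4 N \<alpha>1 \<alpha>2 \<beta> k"
          using A_B_even[of k] C_odd[of k] i m k by simp_all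
        ultimately show ?thesis
          by (simp only: hahn_bcd_simps sum_odd C_even hahn_a_simps)
      qed
      thus "hahn_c N \<alpha>1 \<alpha>2 \<beta> (i + 2) = (?a (3 * i + 5) + ?a (3 * i + 6)) * ?a (3 * i + 4)
          + ?a (3 * i + 5) * ?a (3 * i + 3)"
        "hahn_d N \<alpha>1 \<alpha>2 \<beta> (i + 2) = ?a (3 * i + 5) * ?a (3 * i + 3) * ?a (3 * i + 1)"
        by simp_all
    qed
  qed
qed

section \<open>Positivity in the semi-band\<close>

lemma pochhammer_alternating_sign:
  fixes x :: real
  assumes "x \<le> 1 - real j"
  shows "0 \<le> (- 1) ^ j * pochhammer x j"
  using assms
proof (induction j)
  case (Suc j)
  \<comment> \<open>The hypothesis for \<open>Suc j\<close> says exactly that the new factor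
    \<open>x + j\<close> is at most 0.\<close>
  hence "0 \<le> ((- 1) ^ j * pochhammer x j) * - (x + real j)"
    by (intro mult_nonneg_nonneg[of "(- 1) ^ j * pochhammer x j"]) auto
  thus ?case by (simp add: pochhammer_Suc algebra_simps)
qed simp

text \<open>Four Pochhammer symbols carry the sign \<open>(-1)^j\<close>, so the signs cancel in
  each summand. Strictness comes from the summand \<open>j = 0\<close>, which is 1.\<close>

lemma hyp3F2_pos:
  assumes "x \<le> 1 - real p" "y \<le> 1 - real p" "u \<le> 1 - real p" "v > 0"
  shows "hyp3F2 p x y u v > 0"
  unfolding hyp3F2_def
proof (rule sum_pos2[of _ 0])
  fix j assume j: "j \<in> {..p}"
  have "pochhammer (- real p) j * pochhammer x j * pochhammer y j / (pochhammer u j * pochhammer v j * fact j) =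
    ((- 1) ^ j * pochhammer (- real p) j) * ((- 1) ^ j * pochhammer x j) * ((- 1) ^ j * pochhammer y j)
      / (((- 1) ^ j * pochhammer u j) * pochhammer v j * fact j)"
    by (simp add: minus_one_power_iff)
  also have "0 \<le> \<dots>"
  proof -
    have sign: "0 \<le> (- 1) ^ j * pochhammer z j" if "z \<le> 1 - real j" for z :: real
      using that by (rule pochhammer_alternating_sign)
    have "0 \<le> (- 1) ^ j * pochhammer (- real p) j"
      by (cases "j = p") (use j sign pochhammer_same in auto)
    moreover have "0 \<le> pochhammer v j" using assms(4) by (intro pochhammer_nonneg) simp
    ultimately show ?thesis
      using assms j by (intro divide_nonneg_nonneg mult_nonneg_nonneg sign) auto
  qed
  finally show "0 \<le> pochhammer (- real p) j * pochhammer x j * pochhammer y j / (pochhammer u j * pochhammer v j * fact j)" .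
qed auto

lemma cancel_div_pos: "0 < s \<Longrightarrow> 0 < t \<Longrightarrow> 0 < cancel_div s t"
  by (simp add: cancel_div_def)

context
  fixes N :: nat and \<alpha>1 \<alpha>2 \<beta> :: real
  assumes \<alpha>1: "\<alpha>1 > -1" and \<alpha>2: "\<alpha>2 > -1" and \<beta>: "\<beta> > -1"
    and semi_band: "-1 < \<alpha>1 - \<alpha>2" "\<alpha>1 - \<alpha>2 < 0"
begin

text \<open>\<open>n \<le> N\<close> bounds the parameter \<open>-N\<close>, and \<alpha>2 -
  \<alpha>1 < 1 bounds \<alpha>2 - \<alpha>1 - n; the last lower parameter is positive since
  \<alpha>2 + \<beta> > -2.\<close>

lemma hypF_pos: "n \<le> N \<Longrightarrow> hypF (real N) (\<alpha>2 - \<alpha>1) (\<alpha>2 + \<beta>) n > 0"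
  unfolding hypF_def using \<alpha>2 \<beta> semi_band by (intro hyp3F2_pos) auto

text \<open>Index 0 is separate: the lower parameter \<alpha>2 + \<beta> + 1 need not be positive,
  but the sum is the single summand 1.\<close>

lemma hypH_pos: "n \<le> N \<Longrightarrow> hypH (real N) (\<alpha>2 - \<alpha>1) (\<alpha>2 + \<beta>) n > 0"
  unfolding hypH_def using \<alpha>2 \<beta> semi_band
  by (cases n) (simp add: hyp3F2_def, intro hyp3F2_pos, auto)

text \<open>Each linear factor is positive because \<alpha>1 + \<beta> and \<alpha>2 + \<beta>
  exceed -2 and the shift is at least 2.\<close>

lemma hahn_admissible_semi_band: "hahn_admissible N \<alpha>1 \<alpha>2 \<beta>"
  using hypF_pos hypH_pos \<alpha>1 \<alpha>2 \<beta>
  unfolding hahn_admissible_def hyp_folds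
  by (auto simp: less_le)

lemma hahn_a_positive_semi_band: "hahn_a_positive N \<alpha>1 \<alpha>2 \<beta>"
  unfolding hahn_a_positive_def
proof
  fix i assume i: "i \<in> {1..3 * N}"
  define n where "n = (i - 1) div 6"
  have "i = 6 * n + (i - 1) mod 6 + 1" using i by (simp add: n_def)
  moreover have "(i - 1) mod 6 < 6" by simp
  ultimately consider "i = 6 * n + 1" | "i = 6 * n + 2" | "i = 6 * n + 3" | "i = 6 * n + 4"
    | "i = 6 * n + 5" | "i = 6 * n + 6" by linarith
  thus "hahn_a N \<alpha>1 \<alpha>2 \<beta> i > 0"
  proof cases
    case 1
    \<comment> \<open>As \<open>3 * N\<close> is a multiple of 3, the bound on \<open>i\<close>
      rounds up to the one that makes \<open>N - 2n\<close> positive.\<close>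
    hence N: "2 * n + 1 \<le> N" using i by simp
    hence real_N: "real N \<ge> 2 * real n + 1" by linarith
    \<comment> \<open>At \<open>n = 0\<close> numerator and denominator coincide and need not be
      positive; the quotient is 1 by definition.\<close>
    have "cancel_div (x + \<beta> + 2 * real n + 1) (x + \<beta> + 3 * real n + 1) > 0" if "x > -1" for x
      using that \<beta> by (cases "n = 0") (simp add: cancel_div_def, intro cancel_div_pos, auto)
    thus ?thesis
      unfolding 1 hahn_a_simps hahn_a1_def using \<alpha>1 \<alpha>2 \<beta> real_N
      by (intro mult_pos_pos divide_pos_pos) auto
  next
    case 2
    hence N: "2 * n + 1 \<le> N" using i by simp
    hence real_N: "real N \<ge> 2 * real n + 1" by linarith
    have "cancel_div (\<alpha>2 + \<beta> + real n + 1) (\<alpha>2 + \<beta> + 3 * real n + 1) > 0"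
      using \<alpha>2 \<beta> by (cases "n = 0") (simp add: cancel_div_def, intro cancel_div_pos, auto)
    moreover have "pochhammer (real n) n > 0"
      by (cases "n = 0") (simp, intro pochhammer_pos, auto)
    moreover have "pochhammer (real n + 1) n > 0" by (intro pochhammer_pos) auto
    \<comment> \<open>The factor \<alpha>2 - \<alpha>1 + n is positive even at \<open>n = 0\<close>
      because \<alpha>1 < \<alpha>2.\<close>
    ultimately show ?thesis
      unfolding 2 hahn_a_simps hahn_a2_def hyp_folds using \<alpha>1 \<alpha>2 \<beta> semi_band real_N N
      by (intro mult_pos_pos divide_pos_pos hypF_pos hypH_pos) auto
  next
    case 3
    hence N: "2 * n + 1 \<le> N" using i by simp
    thus ?thesis
      unfolding 3 hahn_a_simps hahn_a3_def hyp_folds pochhammer_2 using \<alpha>1 \<alpha>2 \<beta>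
      by (intro mult_pos_pos divide_pos_pos hypF_pos hypH_pos) auto
  next
    case 4
    hence N: "2 * n + 2 \<le> N" using i by simp
    hence real_N: "real N \<ge> 2 * real n + 2" by linarith
    thus ?thesis
      unfolding 4 hahn_a_simps hahn_a4_def pochhammer_2 using \<alpha>1 \<alpha>2 \<beta>
      by (intro mult_pos_pos divide_pos_pos) auto
  next
    case 5
    hence N: "2 * n + 2 \<le> N" using i by simp
    hence real_N: "real N \<ge> 2 * real n + 2" by linarith
    \<comment> \<open>Positivity of \<alpha>1 - \<alpha>2 + n + 1 at \<open>n = 0\<close> is the
      other half of the semi-band condition.\<close>
    thus ?thesis
      unfolding 5 hahn_a_simps hahn_a5_def hyp_folds pochhammer_2 using \<alpha>1 \<alpha>2 \<beta> semi_band N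
      by (intro mult_pos_pos divide_pos_pos hypF_pos hypH_pos) auto
  next
    case 6
    hence N: "2 * n + 2 \<le> N" using i by simp
    thus ?thesis
      unfolding 6 hahn_a_simps hahn_a6_def hyp_folds pochhammer_2 using \<alpha>1 \<alpha>2 \<beta>
      by (intro mult_pos_pos divide_pos_pos hypF_pos hypH_pos) auto
  qed
qed

end

theorem theorem2p1:
  fixes N :: nat and \<alpha>1 \<alpha>2 \<beta> :: real
  assumes "N \<ge> 1" and "\<alpha>1 > -1" and "\<alpha>2 > -1"
  shows "(hahn_admissible N \<alpha>1 \<alpha>2 \<beta> \<longrightarrow>
            (\<forall>m\<in>{1..N + 1}. hahn_T N \<alpha>1 \<alpha>2 \<beta> m =
               L1_mat (hahn_a N \<alpha>1 \<alpha>2 \<beta>) m * L2_mat (hahn_a N \<alpha>1 \<alpha>2 \<beta>) m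
                 * U_mat (hahn_a N \<alpha>1 \<alpha>2 \<beta>) m))
       \<and> (\<beta> > -1 \<and> -1 < \<alpha>1 - \<alpha>2 \<and> \<alpha>1 - \<alpha>2 < 0 \<longrightarrow>
            (\<forall>m\<in>{1..N + 1}. hahn_T N \<alpha>1 \<alpha>2 \<beta> m =
               L1_mat (hahn_a N \<alpha>1 \<alpha>2 \<beta>) m * L2_mat (hahn_a N \<alpha>1 \<alpha>2 \<beta>) m
                 * U_mat (hahn_a N \<alpha>1 \<alpha>2 \<beta>) m)
            \<and> hahn_a_positive N \<alpha>1 \<alpha>2 \<beta>)"
  using hahn_T_factorization[of N \<alpha>1 \<alpha>2 \<beta>] hahn_admissible_semi_band[of \<alpha>1 \<alpha>2 \<beta> N]
    hahn_a_positive_semi_band[of \<alpha>1 \<alpha>2 \<beta> N] assms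
  by auto

end
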